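(* Let $\mathcal{M}$ be a Riemannian manifold equipped with a retraction $\mathrm{R}$, let $f\colon\mathcal{M}\to\mathbb{R}$ be twice continuously differentiable, let $x_0\in\mathcal{M}$, and consider a run of the ARC algorithm (described in the context) with retraction $\mathrm{R}$ started at $x_0$, producing iterates $x_k$, trial steps $s_k$ and pullbacks $\hat f_k=f\circ\mathrm{R}_{x_k}$. Assume: (a) there is a finite $f_{\mathrm{low}}$ with $f(x)\ge f_{\mathrm{low}}$ for all $x\in\mathcal{M}$; (b) there is a constant $L$ such that at each iteration $k$, $\hat f_k(s_k)-\big[\hat f_k(0)+\langle s_k,\nabla\hat f_k(0)\rangle+\frac12\langle s_k,\nabla^2\hat f_k(0)[s_k]\rangle\big]\le\frac L6\|s_k\|^3$; and there are a constant $L'$ and a continuous function $q\colon\mathbb{R}^+\to\mathbb{R}^+$ with $q(0)=0$ such that at each successful iteration $k$, $\|\nabla\hat f_k(s_k)-\nabla\hat f_k(0)-\nabla^2\hat f_k(0)[s_k]\|\le\frac{L'}2\|s_k\|^2+q(\|s_k\|)\,\|\mathrm{grad} f(\mathrm{R}_{x_k}(s_k))\|$; (c) there are constants $a>0$ (possibly $+\infty$) and $b>0$ such that at each successful iteration $k$, if $\|s_k\|\le a$ then $\sigma_{\min}(\mathrm{D}\mathrm{R}_{x_k}(s_k))\ge b$. Then for all sufficiently small $\varepsilon>0$ the algorithm produces an iterate $x_k\in\mathcal{M}$ such that $f(x_k)\le f(x_0)$, $\|\mathrm{grad} f(x_k)\|_{x_k}\le\varepsilon$ and, if the second-order progress condition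 is enforced at each iteration and $\mathrm{R}$ is a second-order retraction, also $\lambda_{\min}(\mathrm{Hess} f(x_k))\ge-\sqrt\varepsilon$, with $k=\tilde O(1/\varepsilon^{1.5})$; that is, there are constants $\varepsilon_0>0$, $C\geq 0$, $p\ge0$ independent of $\varepsilon$ such that for every $\varepsilon\in(0,\varepsilon_0]$ such an iterate exists with $k\le C\,\varepsilon^{-1.5}(1+|\log\varepsilon|)^p$.
   Context: Notation. $\mathrm{T}_x\mathcal{M}$ is the tangent space at $x$ with Riemannian inner product $\langle\cdot,\cdot\rangle$ and norm $\|\cdot\|$ (or $\|\cdot\|_x$); $\mathrm{T}\mathcal{M}$ is the tangent bundle; $\mathrm{grad} f$ and $\mathrm{Hess} f$ are the Riemannian gradient and Hessian; $\lambda_{\min}$ is the smallest eigenvalue of a self-adjoint operator, $\sigma_{\min}$ the smallest singular value of a linear operator; $\nabla,\nabla^2$ are the usual gradient and Hessian of functions on the Euclidean space $\mathrm{T}_x\mathcal{M}$. A retraction is a smooth map $\mathrm{R}\colon\mathrm{T}\mathcal{M}\to\mathcal{M}$, $(x,s)\mapsto\mathrm{R}_x(s)$, such that for each $x$, $\mathrm{R}_x(0)=x$ and $\mathrm{D}\mathrm{R}_x(0)$ is the identity on $\mathrm{T}_x\mathcal{M}$. It is second order if for all $x\in\mathcal{M}$, $\dot s\in\mathrm{T}_x\mathcal{M}$, the curve $c(t)=\mathrm{R}_x(t\dot s)$ has zero initial intrinsic acceleration: $c''(0)=0$, where $c''$ is the covariant derivative of $c'$ along $c$. ARC algorithm with retraction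 $\mathrm{R}$. Parameters: $\theta>0$, $\varsigma_{\min}>0$, $0<\eta_1\le\eta_2<1$, $0<\gamma_1<1<\gamma_2<\gamma_3$. Input: $x_0\in\mathcal{M}$, $\varsigma_0\ge\varsigma_{\min}$. For $k=0,1,2,\ldots$: let $\hat f_k=f\circ\mathrm{R}_{x_k}\colon\mathrm{T}_{x_k}\mathcal{M}\to\mathbb{R}$ and define $m_k(s)=\hat f_k(0)+\langle s,\nabla\hat f_k(0)\rangle+\frac12\langle s,\nabla^2\hat f_k(0)[s]\rangle+\frac{\varsigma_k}{3}\|s\|^3$. A subproblem solver returns any $s_k\in\mathrm{T}_{x_k}\mathcal{M}$ satisfying the first-order progress conditions $m_k(s_k)\le m_k(0)$ and $\|\nabla m_k(s_k)\|\le\theta\|s_k\|^2$; optionally (when "second-order progress is enforced") $s_k$ must also satisfy $\lambda_{\min}(\nabla^2m_k(s_k))\ge-\theta\|s_k\|$. If $s_k=0$, terminate. Otherwise compute $\rho_k=\dfrac{f(x_k)-f(\mathrm{R}_{x_k}(s_k))}{m_k(0)-m_k(s_k)+\frac{\varsigma_k}{3}\|s_k\|^3}$. If $\rho_k\ge\eta_1$ (iteration $k$ is successful), set $x_{k+1}=\mathrm{R}_{x_k}(s_k)$; otherwise (unsuccessful) set $x_{k+1}=x_k$. Choose $\varsigma_{k+1}\in[\max(\varsigma_{\min},\gamma_1\varsigma_k),\varsigma_k]$ if $\rho_k\ge\eta_2$; $\varsigma_{k+1}\in[\varsigma_k,\gamma_2\varsigma_k]$ if $\rho_k\in[\eta_1,\eta_2)$;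 $\varsigma_{k+1}\in[\gamma_2\varsigma_k,\gamma_3\varsigma_k]$ if $\rho_k<\eta_1$. *)

theory Defs
  imports "HOL-Analysis.Analysis"
begin

section \<open>Smooth functions between Euclidean spaces\<close>

text \<open>
  For open \<open>S\<close> in finite dimension, \<open>C_on k f S\<close> says that \<open>f\<close> is \<open>C\<^sup>k\<close> on \<open>S\<close>:
  continuity of all directional derivatives \<open>x \<mapsto> Df(x)[v]\<close> is continuity of \<open>Df\<close>.
\<close>

primrec C_on :: "nat \<Rightarrow> ('a::euclidean_space \<Rightarrow> 'b::real_normed_vector) \<Rightarrow> 'a set \<Rightarrow> bool" where
  "C_on 0 f S \<longleftrightarrow> continuous_on S f"
| "C_on (Suc k) f S \<longleftrightarrow>
     (\<forall>x\<in>S. f differentiable (at x)) \<and> (\<forall>v. C_on k (\<lambda>x. frechet_derivative f (at x) v) S)"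

definition smooth_on :: "('a::euclidean_space \<Rightarrow> 'b::real_normed_vector) \<Rightarrow> 'a set \<Rightarrow> bool" where
  "smooth_on f S \<longleftrightarrow> (\<forall>k. C_on k f S)"


section \<open>Riemannian manifolds\<close>

text \<open>
  A chart is a pair of a domain and a coordinate map. The model space \<open>'e\<close> carries the dimension
  of the manifold. The tangent space at \<open>x\<close> is the vector space \<open>'e\<close>: the vector \<open>v :: 'e\<close> at \<open>x\<close>
  stands for the tangent vector whose components in the preferred chart \<open>chart_at M x\<close> are \<open>v\<close>.
  The inner product of tangent vectors is \<open>metric M x\<close>, never the inner product of the type \<open>'e\<close>.
\<close>

type_synonym ('m, 'e) chart = "'m set \<times> ('m \<Rightarrow> 'e)"

definition chart_inv :: "('m, 'e) chart \<Rightarrow> 'e \<Rightarrow> 'm" where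
  "chart_inv c = inv_into (fst c) (snd c)"

record ('m, 'e) riem =
  top_of :: "'m topology"
  atlas :: "('m, 'e) chart set"
  metric :: "'m \<Rightarrow> 'e \<Rightarrow> 'e \<Rightarrow> real"

abbreviation points :: "('m, 'e) riem \<Rightarrow> 'm set" where
  "points M \<equiv> topspace (top_of M)"

definition is_chart :: "'m topology \<Rightarrow> ('m, 'e::euclidean_space) chart \<Rightarrow> bool" where
  "is_chart X c \<longleftrightarrow> openin X (fst c) \<and> open (snd c ` fst c) \<and>
     homeomorphic_map (subtopology X (fst c)) (top_of_set (snd c ` fst c)) (snd c)"

definition smooth_manifold :: "('m, 'e::euclidean_space) riem \<Rightarrow> bool" where
  "smooth_manifold M \<longleftrightarrow>
     Hausdorff_space (top_of M) \<and> second_countable (top_of M) \<and>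
     (\<forall>c\<in>atlas M. is_chart (top_of M) c) \<and>
     (\<Union>c\<in>atlas M. fst c) = points M \<and>
     (\<forall>c\<in>atlas M. \<forall>d\<in>atlas M. smooth_on (snd d \<circ> chart_inv c) (snd c ` (fst c \<inter> fst d)))"

definition chart_at :: "('m, 'e) riem \<Rightarrow> 'm \<Rightarrow> ('m, 'e) chart" where
  "chart_at M x = (SOME c. c \<in> atlas M \<and> x \<in> fst c)"

text \<open>
  Change of components of a tangent vector at \<open>x\<close>: from the preferred chart at \<open>x\<close> to the chart
  \<open>c\<close>, and back.
\<close>

definition to_chart :: "('m, 'e::euclidean_space) riem \<Rightarrow> ('m, 'e) chart \<Rightarrow> 'm \<Rightarrow> 'e \<Rightarrow> 'e" where
  "to_chart M c x =
     frechet_derivative (snd c \<circ> chart_inv (chart_at M x)) (at (snd (chart_at M x) x))"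

definition from_chart :: "('m, 'e::euclidean_space) riem \<Rightarrow> ('m, 'e) chart \<Rightarrow> 'm \<Rightarrow> 'e \<Rightarrow> 'e" where
  "from_chart M c x = frechet_derivative (snd (chart_at M x) \<circ> chart_inv c) (at (snd c x))"

text \<open>The metric at the point with coordinates \<open>u\<close>, applied to components in the chart \<open>c\<close>.\<close>

definition chart_metric ::
  "('m, 'e::euclidean_space) riem \<Rightarrow> ('m, 'e) chart \<Rightarrow> 'e \<Rightarrow> 'e \<Rightarrow> 'e \<Rightarrow> real" where
  "chart_metric M c u v w =
     (let x = chart_inv c u in metric M x (from_chart M c x v) (from_chart M c x w))"

definition riemannian_manifold :: "('m, 'e::euclidean_space) riem \<Rightarrow> bool" where
  "riemannian_manifold M \<longleftrightarrow>
     smooth_manifold M \<and>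
     (\<forall>x\<in>points M. bilinear (metric M x) \<and>
        (\<forall>v w. metric M x v w = metric M x w v) \<and>
        (\<forall>v. v \<noteq> 0 \<longrightarrow> metric M x v v > 0)) \<and>
     (\<forall>c\<in>atlas M. \<forall>v w. smooth_on (\<lambda>u. chart_metric M c u v w) (snd c ` fst c))"

definition tnorm :: "('m, 'e) riem \<Rightarrow> 'm \<Rightarrow> 'e \<Rightarrow> real" where
  "tnorm M x v = sqrt (metric M x v v)"


section \<open>Levi-Civita connection, Riemannian gradient and Hessian\<close>

text \<open>
  The Christoffel symbols of the Levi-Civita connection in a chart: \<open>christoffel M c u v w\<close> has
  components \<open>\<Sum>i j. \<Gamma>\<^sup>k\<^sub>i\<^sub>j v\<^sub>i w\<^sub>j\<close>. The equation is Koszul's formula for coordinate vector fields,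
  whose Lie brackets vanish.
\<close>

definition christoffel ::
  "('m, 'e::euclidean_space) riem \<Rightarrow> ('m, 'e) chart \<Rightarrow> 'e \<Rightarrow> 'e \<Rightarrow> 'e \<Rightarrow> 'e" where
  "christoffel M c u v w = (THE y. \<forall>z. chart_metric M c u y z =
     (frechet_derivative (\<lambda>u. chart_metric M c u w z) (at u) v +
      frechet_derivative (\<lambda>u. chart_metric M c u v z) (at u) w -
      frechet_derivative (\<lambda>u. chart_metric M c u v w) (at u) z) / 2)"

text \<open>\<open>cov_deriv M V x v\<close> is the covariant derivative at \<open>x\<close> of the vector field \<open>V\<close> along \<open>v\<close>.\<close>

definition cov_deriv ::
  "('m, 'e::euclidean_space) riem \<Rightarrow> ('m \<Rightarrow> 'e) \<Rightarrow> 'm \<Rightarrow> 'e \<Rightarrow> 'e" where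
  "cov_deriv M V x v =
     (let c = chart_at M x in
        frechet_derivative (\<lambda>u. to_chart M c (chart_inv c u) (V (chart_inv c u))) (at (snd c x)) v +
        christoffel M c (snd c x) v (V x))"

definition velocity :: "('m, 'e::euclidean_space) riem \<Rightarrow> (real \<Rightarrow> 'm) \<Rightarrow> real \<Rightarrow> 'e" where
  "velocity M \<gamma> t = vector_derivative (\<lambda>\<tau>. snd (chart_at M (\<gamma> t)) (\<gamma> \<tau>)) (at t)"

text \<open>\<open>cov_deriv_along M \<gamma> Z t\<close> is the covariant derivative of the vector field \<open>Z\<close> along the curve \<open>\<gamma>\<close>.\<close>

definition cov_deriv_along ::
  "('m, 'e::euclidean_space) riem \<Rightarrow> (real \<Rightarrow> 'm) \<Rightarrow> (real \<Rightarrow> 'e) \<Rightarrow> real \<Rightarrow> 'e" where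
  "cov_deriv_along M \<gamma> Z t =
     (let c = chart_at M (\<gamma> t) in
        vector_derivative (\<lambda>\<tau>. to_chart M c (\<gamma> \<tau>) (Z \<tau>)) (at t) +
        christoffel M c (snd c (\<gamma> t)) (velocity M \<gamma> t) (Z t))"

definition acceleration :: "('m, 'e::euclidean_space) riem \<Rightarrow> (real \<Rightarrow> 'm) \<Rightarrow> real \<Rightarrow> 'e" where
  "acceleration M \<gamma> = cov_deriv_along M \<gamma> (velocity M \<gamma>)"

definition C2_function :: "('m, 'e::euclidean_space) riem \<Rightarrow> ('m \<Rightarrow> real) \<Rightarrow> bool" where
  "C2_function M f \<longleftrightarrow> (\<forall>c\<in>atlas M. C_on 2 (f \<circ> chart_inv c) (snd c ` fst c))"

definition differential :: "('m, 'e::euclidean_space) riem \<Rightarrow> ('m \<Rightarrow> real) \<Rightarrow> 'm \<Rightarrow> 'e \<Rightarrow> real" where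
  "differential M f x =
     frechet_derivative (f \<circ> chart_inv (chart_at M x)) (at (snd (chart_at M x) x))"

definition rgrad :: "('m, 'e::euclidean_space) riem \<Rightarrow> ('m \<Rightarrow> real) \<Rightarrow> 'm \<Rightarrow> 'e" where
  "rgrad M f x = (THE u. \<forall>v. metric M x u v = differential M f x v)"

definition rhess :: "('m, 'e::euclidean_space) riem \<Rightarrow> ('m \<Rightarrow> real) \<Rightarrow> 'm \<Rightarrow> 'e \<Rightarrow> 'e" where
  "rhess M f x v = cov_deriv M (rgrad M f) x v"


section \<open>Calculus and linear algebra on a tangent space\<close>

text \<open>Gradient and Hessian of \<open>h\<close> on the tangent space at \<open>x\<close> with inner product \<open>metric M x\<close>.\<close>

definition tgrad :: "('m, 'e::euclidean_space) riem \<Rightarrow> 'm \<Rightarrow> ('e \<Rightarrow> real) \<Rightarrow> 'e \<Rightarrow> 'e" where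
  "tgrad M x h s = (THE u. \<forall>v. metric M x u v = frechet_derivative h (at s) v)"

definition thess :: "('m, 'e::euclidean_space) riem \<Rightarrow> 'm \<Rightarrow> ('e \<Rightarrow> real) \<Rightarrow> 'e \<Rightarrow> 'e \<Rightarrow> 'e" where
  "thess M x h s = frechet_derivative (tgrad M x h) (at s)"

definition lambda_min :: "('e::real_vector \<Rightarrow> 'e) \<Rightarrow> real" where
  "lambda_min T = (LEAST l. \<exists>v. v \<noteq> 0 \<and> T v = l *\<^sub>R v)"

text \<open>Adjoint of a linear map from the tangent space at \<open>x\<close> to the tangent space at \<open>y\<close>.\<close>

definition tadjoint :: "('m, 'e) riem \<Rightarrow> 'm \<Rightarrow> 'm \<Rightarrow> ('e \<Rightarrow> 'e) \<Rightarrow> 'e \<Rightarrow> 'e" where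
  "tadjoint M x y T w = (THE v. \<forall>u. metric M x v u = metric M y w (T u))"

definition sigma_min :: "('m, 'e::real_vector) riem \<Rightarrow> 'm \<Rightarrow> 'm \<Rightarrow> ('e \<Rightarrow> 'e) \<Rightarrow> real" where
  "sigma_min M x y T = sqrt (lambda_min (tadjoint M x y T \<circ> T))"


section \<open>Retractions\<close>

text \<open>Differential at \<open>s\<close> of the map \<open>R x\<close> from the tangent space at \<open>x\<close> to the manifold.\<close>

definition D_retr ::
  "('m, 'e::euclidean_space) riem \<Rightarrow> ('m \<Rightarrow> 'e \<Rightarrow> 'm) \<Rightarrow> 'm \<Rightarrow> 'e \<Rightarrow> 'e \<Rightarrow> 'e" where
  "D_retr M R x s = frechet_derivative (\<lambda>s'. snd (chart_at M (R x s)) (R x s')) (at s)"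

text \<open>
  Smoothness of \<open>R\<close> as a map from the tangent bundle to \<open>M\<close>, in the bundle chart \<open>(u, w)\<close> induced
  by \<open>c\<close> (\<open>u\<close> the coordinates of the base point, \<open>w\<close> the components of the vector) and the chart \<open>d\<close>.
  Openness of the domains \<open>W\<close> and continuity of the coordinate expressions give continuity of \<open>R\<close>.
\<close>

definition smooth_on_TM ::
  "('m, 'e::euclidean_space) riem \<Rightarrow> ('m \<Rightarrow> 'e \<Rightarrow> 'm) \<Rightarrow> bool" where
  "smooth_on_TM M R \<longleftrightarrow> (\<forall>c\<in>atlas M. \<forall>d\<in>atlas M.
     let R' = (\<lambda>(u, w). R (chart_inv c u) (from_chart M c (chart_inv c u) w));
         W = {(u, w). u \<in> snd c ` fst c \<and> R' (u, w) \<in> fst d}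
     in open W \<and> smooth_on (snd d \<circ> R') W)"

definition retraction_on ::
  "('m, 'e::euclidean_space) riem \<Rightarrow> ('m \<Rightarrow> 'e \<Rightarrow> 'm) \<Rightarrow> bool" where
  "retraction_on M R \<longleftrightarrow>
     (\<forall>x\<in>points M. \<forall>s. R x s \<in> points M) \<and> smooth_on_TM M R \<and>
     (\<forall>x\<in>points M. R x 0 = x \<and> (\<forall>v. D_retr M R x 0 v = v))"

definition second_order_retraction ::
  "('m, 'e::euclidean_space) riem \<Rightarrow> ('m \<Rightarrow> 'e \<Rightarrow> 'm) \<Rightarrow> bool" where
  "second_order_retraction M R \<longleftrightarrow>
     retraction_on M R \<and> (\<forall>x\<in>points M. \<forall>v. acceleration M (\<lambda>t. R x (t *\<^sub>R v)) 0 = 0)"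


section \<open>Adaptive regularization with cubics\<close>

definition pullback :: "('m \<Rightarrow> real) \<Rightarrow> ('m \<Rightarrow> 'e \<Rightarrow> 'm) \<Rightarrow> 'm \<Rightarrow> 'e \<Rightarrow> real" where
  "pullback f R x = f \<circ> R x"

definition taylor2 :: "('m, 'e::euclidean_space) riem \<Rightarrow> 'm \<Rightarrow> ('e \<Rightarrow> real) \<Rightarrow> 'e \<Rightarrow> real" where
  "taylor2 M x h s =
     h 0 + metric M x s (tgrad M x h 0) + (1/2) * metric M x s (thess M x h 0 s)"

definition arc_model ::
  "('m, 'e::euclidean_space) riem \<Rightarrow> ('m \<Rightarrow> 'e \<Rightarrow> 'm) \<Rightarrow> ('m \<Rightarrow> real) \<Rightarrow> 'm \<Rightarrow> real \<Rightarrow> 'e \<Rightarrow> real" where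
  "arc_model M R f x \<sigma> s = taylor2 M x (pullback f R x) s + \<sigma> / 3 * tnorm M x s ^ 3"

definition arc_ratio ::
  "('m, 'e::euclidean_space) riem \<Rightarrow> ('m \<Rightarrow> 'e \<Rightarrow> 'm) \<Rightarrow> ('m \<Rightarrow> real) \<Rightarrow> 'm \<Rightarrow> real \<Rightarrow> 'e \<Rightarrow> real" where
  "arc_ratio M R f x \<sigma> s = (f x - f (R x s)) /
     (arc_model M R f x \<sigma> 0 - arc_model M R f x \<sigma> s + \<sigma> / 3 * tnorm M x s ^ 3)"

definition first_order_progress ::
  "('m, 'e::euclidean_space) riem \<Rightarrow> ('m \<Rightarrow> 'e \<Rightarrow> 'm) \<Rightarrow> ('m \<Rightarrow> real) \<Rightarrow> real \<Rightarrow> 'm \<Rightarrow> real \<Rightarrow> 'e \<Rightarrow> bool"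
  where "first_order_progress M R f \<theta> x \<sigma> s \<longleftrightarrow>
     arc_model M R f x \<sigma> s \<le> arc_model M R f x \<sigma> 0 \<and>
     tnorm M x (tgrad M x (arc_model M R f x \<sigma>) s) \<le> \<theta> * (tnorm M x s)\<^sup>2"

definition second_order_progress ::
  "('m, 'e::euclidean_space) riem \<Rightarrow> ('m \<Rightarrow> 'e \<Rightarrow> 'm) \<Rightarrow> ('m \<Rightarrow> real) \<Rightarrow> real \<Rightarrow> 'm \<Rightarrow> real \<Rightarrow> 'e \<Rightarrow> bool"
  where "second_order_progress M R f \<theta> x \<sigma> s \<longleftrightarrow>
     lambda_min (thess M x (arc_model M R f x \<sigma>) s) \<ge> - \<theta> * tnorm M x s"

text \<open>
  A run is given by total sequences; only the part up to termination (the first \<open>k\<close> with \<open>s k = 0\<close>)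
  is meaningful. Iteration \<open>k\<close> takes place, and \<open>x k\<close> is an iterate of the algorithm, exactly when
  no earlier trial step vanishes.
\<close>

definition reached :: "(nat \<Rightarrow> 'e::zero) \<Rightarrow> nat \<Rightarrow> bool" where
  "reached s k \<longleftrightarrow> (\<forall>j<k. s j \<noteq> 0)"

definition successful ::
  "('m, 'e::euclidean_space) riem \<Rightarrow> ('m \<Rightarrow> 'e \<Rightarrow> 'm) \<Rightarrow> ('m \<Rightarrow> real) \<Rightarrow> real \<Rightarrow>
   (nat \<Rightarrow> 'm) \<Rightarrow> (nat \<Rightarrow> 'e) \<Rightarrow> (nat \<Rightarrow> real) \<Rightarrow> nat \<Rightarrow> bool" where
  "successful M R f \<eta>1 x s \<sigma> k \<longleftrightarrow>
     reached s k \<and> s k \<noteq> 0 \<and> arc_ratio M R f (x k) (\<sigma> k) (s k) \<ge> \<eta>1"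

definition arc_params ::
  "real \<Rightarrow> real \<Rightarrow> real \<Rightarrow> real \<Rightarrow> real \<Rightarrow> real \<Rightarrow> real \<Rightarrow> bool" where
  "arc_params \<theta> \<sigma>min \<eta>1 \<eta>2 \<gamma>1 \<gamma>2 \<gamma>3 \<longleftrightarrow>
     \<theta> > 0 \<and> \<sigma>min > 0 \<and> 0 < \<eta>1 \<and> \<eta>1 \<le> \<eta>2 \<and> \<eta>2 < 1 \<and> 0 < \<gamma>1 \<and> \<gamma>1 < 1 \<and> 1 < \<gamma>2 \<and> \<gamma>2 < \<gamma>3"

definition arc_run ::
  "('m, 'e::euclidean_space) riem \<Rightarrow> ('m \<Rightarrow> 'e \<Rightarrow> 'm) \<Rightarrow> ('m \<Rightarrow> real) \<Rightarrow>
   real \<Rightarrow> real \<Rightarrow> real \<Rightarrow> real \<Rightarrow> real \<Rightarrow> real \<Rightarrow> real \<Rightarrow>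
   'm \<Rightarrow> (nat \<Rightarrow> 'm) \<Rightarrow> (nat \<Rightarrow> 'e) \<Rightarrow> (nat \<Rightarrow> real) \<Rightarrow> bool" where
  "arc_run M R f \<theta> \<sigma>min \<eta>1 \<eta>2 \<gamma>1 \<gamma>2 \<gamma>3 x0 x s \<sigma> \<longleftrightarrow>
     x 0 = x0 \<and> \<sigma> 0 \<ge> \<sigma>min \<and>
     (\<forall>k. reached s k \<longrightarrow> first_order_progress M R f \<theta> (x k) (\<sigma> k) (s k)) \<and>
     (\<forall>k. reached s k \<and> s k \<noteq> 0 \<longrightarrow>
        (let \<rho> = arc_ratio M R f (x k) (\<sigma> k) (s k) in
           x (Suc k) = (if \<rho> \<ge> \<eta>1 then R (x k) (s k) else x k) \<and>
           (\<rho> \<ge> \<eta>2 \<longrightarrow> \<sigma> (Suc k) \<in> {max \<sigma>min (\<gamma>1 * \<sigma> k) .. \<sigma> k}) \<and>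
           (\<eta>1 \<le> \<rho> \<and> \<rho> < \<eta>2 \<longrightarrow> \<sigma> (Suc k) \<in> {\<sigma> k .. \<gamma>2 * \<sigma> k}) \<and>
           (\<rho> < \<eta>1 \<longrightarrow> \<sigma> (Suc k) \<in> {\<gamma>2 * \<sigma> k .. \<gamma>3 * \<sigma> k})))"

end

theory Submission
  imports Defs
begin

text \<open>
  While the weights \<open>\<sigma> k\<close> stay between \<open>\<sigma>min\<close> and some \<open>\<sigma>max\<close>, each successful step of length \<open>n\<close>
  decreases \<open>f\<close> by a multiple of \<open>n\<^sup>3\<close>, so only \<open>O(\<delta>\<^sup>-\<^sup>3)\<close> successful steps are longer than \<open>\<delta>\<close>, and
  the unsuccessful ones are at most proportional in number to the successful ones. Hence within
  \<open>O(\<delta>\<^sup>-\<^sup>3)\<close> iterations either the run stops or two consecutive successful steps \<open>i < j\<close> are shorter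
  than \<open>\<delta>\<close>. The iterate \<open>x j = R (x i) (s i)\<close> then serves for both conditions: shortness of \<open>s i\<close>
  bounds its gradient by a multiple of \<open>\<delta>\<^sup>2\<close>, and shortness of \<open>s j\<close> bounds the negative curvature of
  the pullback at \<open>x j\<close>, which is that of \<open>f\<close> for a second-order retraction, by a multiple of \<open>\<delta>\<close>.
  Take \<open>\<delta>\<close> proportional to \<open>sqrt \<epsilon>\<close>; no logarithm is needed.
\<close>

section \<open>Inner products on a Euclidean space\<close>

text \<open>A trial step informs about two different points: the gradient test of
  \<open>first_order_progress\<close> bounds the gradient where the step lands, while
  \<open>second_order_progress\<close> bounds the Hessian of the pullback where it starts. So one
  short step is not enough; the landing point of \<open>s i\<close> is the starting point of
  \<open>s j\<close> because the iterations between two consecutive successes leave the iterate in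
  place. The weights stay bounded because a large \<open>\<sigma> k\<close> dominates the cubic
  error allowed by \<open>L\<close>, which makes the ratio at least \<open>\<eta>2\<close> and
  forbids an increase. On the geometric side, gradients, adjoints and Christoffel symbols are
  definite descriptions and \<open>lambda_min\<close> is a least element, so existence must be shown
  before anything can be computed. Preferred charts are chosen point by point without any
  continuity, so fields are differentiated in one fixed chart. As \<open>f\<close> is only C2,
  differentiability of its gradient field in a chart has to be derived from the equation that
  defines the gradient.\<close>

lemma linear_expand:
  fixes \<phi> :: "'e::euclidean_space \<Rightarrow> 'b::real_vector"
  assumes "linear \<phi>"
  shows "\<phi> v = (\<Sum>b\<in>Basis. (v \<bullet> b) *\<^sub>R \<phi> b)"
  by (subst (1) euclidean_representation[of v, symmetric])
     (simp add: linear_sum[OF assms] linear_scale[OF assms])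

text \<open>Along \<open>v + t *\<^sub>R w\<close> the form is a quadratic polynomial in
  \<open>t\<close> without constant term, so a nonzero linear coefficient would make it negative
  somewhere. It serves to turn a minimiser of a Rayleigh quotient into an eigenvector.\<close>

lemma psd_null_vector:
  fixes B :: "'e::euclidean_space \<Rightarrow> 'e \<Rightarrow> real"
  assumes "bilinear B" and sym: "\<And>v w. B v w = B w v" and psd: "\<And>v. B v v \<ge> 0"
    and null: "B v v = 0"
  shows "B v w = 0"
proof -
  interpret B: bounded_bilinear B
    using assms(1) by (simp add: bilinear_conv_bounded_bilinear)
  let ?\<beta> = "B v w" and ?\<gamma> = "B w w"
  \<comment> \<open>The polynomial has its minimum at \<open>- ?\<beta> / ?\<gamma>\<close>; adding
    1 to the denominator admits \<open>?\<gamma> = 0\<close> and still gives the value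
    \<open>- t^2 * (?\<gamma> + 2)\<close>.\<close>
  define t where "t = - ?\<beta> / (?\<gamma> + 1)"
  have \<gamma>: "?\<gamma> \<ge> 0" by (rule psd)
  then have t: "t * (?\<gamma> + 1) = - ?\<beta>"
    by (simp add: t_def)
  have "0 \<le> B (v + t *\<^sub>R w) (v + t *\<^sub>R w)" by (rule psd)
  also have "\<dots> = 2 * t * ?\<beta> + t^2 * ?\<gamma>"
    using null sym[of w v]
    by (simp add: B.add_left B.add_right B.scaleR_left B.scaleR_right power2_eq_square algebra_simps)
  also have "?\<beta> = - (t * (?\<gamma> + 1))"
    using t by simp
  finally have "t\<^sup>2 * (?\<gamma> + 2) \<le> 0"
    by (simp add: power2_eq_square algebra_simps)
  then have "t = 0"
    using \<gamma> by (simp add: mult_le_0_iff)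
  then show ?thesis
    using t by simp
qed

text \<open>All tangent spaces share the type \<open>'e\<close> and differ only in their inner
  product, which is therefore a locale parameter. It is instantiated both by
  \<open>metric M x\<close> and by \<open>chart_metric M c u\<close>.\<close>

locale inner_form =
  fixes g :: "'e::euclidean_space \<Rightarrow> 'e \<Rightarrow> real"
  assumes bilinear: "bilinear g"
    and commute: "g v w = g w v"
    and positive: "v \<noteq> 0 \<Longrightarrow> g v v > 0"
begin

lemma bounded_bilinear: "bounded_bilinear g"
  using bilinear by (simp add: bilinear_conv_bounded_bilinear)

sublocale bounded_bilinear g
  by (rule bounded_bilinear)

lemma nonneg: "g v v \<ge> 0"
  by (cases "v = 0") (auto simp: zero_left intro: less_imp_le[OF positive])

lemma eq_zero_iff: "g v v = 0 \<longleftrightarrow> v = 0"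
  using positive[of v] by (cases "v = 0") (auto simp: zero_left)

lemma eqI: "(\<And>w. g u w = g v w) \<Longrightarrow> u = v"
  using eq_zero_iff[of "u - v"] by (simp add: diff_left)

definition nrm :: "'e \<Rightarrow> real" where
  "nrm v = sqrt (g v v)"

lemma nrm_nonneg [simp]: "nrm v \<ge> 0"
  by (simp add: nrm_def nonneg)

lemma nrm_square: "(nrm v)\<^sup>2 = g v v"
  by (simp add: nrm_def nonneg)

lemma nrm_eq_0_iff [simp]: "nrm v = 0 \<longleftrightarrow> v = 0"
  by (simp add: nrm_def eq_zero_iff)

lemma nrm_zero [simp]: "nrm 0 = 0"
  by simp

lemma nrm_scaleR: "nrm (c *\<^sub>R v) = \<bar>c\<bar> * nrm v"
  by (simp add: nrm_def scaleR_left scaleR_right real_sqrt_mult flip: mult.assoc)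

lemma nrm_minus: "nrm (- v) = nrm v"
  using nrm_scaleR[of "-1" v] by simp

lemma cauchy_schwarz: "g v w \<le> nrm v * nrm w"
proof (cases "v = 0 \<or> w = 0")
  case True
  then show ?thesis by (auto simp: zero_left zero_right)
next
  case False
  let ?a = "nrm v" and ?b = "nrm w"
  have pos: "?a > 0" "?b > 0"
    using False nrm_nonneg[of v] nrm_nonneg[of w] nrm_eq_0_iff[of v] nrm_eq_0_iff[of w]
    by linarith+
  have "0 \<le> g (?b *\<^sub>R v - ?a *\<^sub>R w) (?b *\<^sub>R v - ?a *\<^sub>R w)" by (rule nonneg)
  also have "\<dots> = ?b^2 * g v v - 2 * ?a * ?b * g v w + ?a^2 * g w w"
    using commute[of w v]
    by (simp add: diff_left diff_right scaleR_left scaleR_right power2_eq_square algebra_simps)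
  also have "\<dots> = (2 * ?a * ?b) * (?a * ?b - g v w)"
    by (simp add: nrm_square[symmetric] power2_eq_square algebra_simps)
  finally have "0 \<le> ?a * ?b - g v w"
    using pos mult_pos_pos[OF pos] by (auto simp: zero_le_mult_iff)
  then show ?thesis
    by simp
qed

lemma nrm_add: "nrm (v + w) \<le> nrm v + nrm w"
proof (rule power2_le_imp_le)
  show "(nrm (v + w))\<^sup>2 \<le> (nrm v + nrm w)\<^sup>2"
    using cauchy_schwarz[of v w] commute[of w v]
    by (simp add: nrm_square add_left add_right power2_sum)
qed simp

text \<open>The coordinate vector \<open>A u\<close> of the functional \<open>g u\<close> depends
  linearly and, by definiteness, injectively on \<open>u\<close>; in finite dimension
  \<open>A\<close> is then onto.\<close>

lemma riesz:
  assumes "linear \<phi>"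
  shows "\<exists>!u. \<forall>v. g u v = \<phi> v"
proof -
  define A where "A u = (\<Sum>b\<in>Basis. g u b *\<^sub>R b)" for u
  have A_inner: "A u \<bullet> b = g u b" if "b \<in> Basis" for u b
    using that by (simp add: A_def inner_sum_left inner_Basis if_distrib sum.delta cong: if_cong)
  have "linear A"
    unfolding A_def
    by (intro linear_compose_sum ballI linearI)
       (simp_all add: add_left scaleR_left scaleR_left_distrib)
  have ext: "g u v = (\<Sum>b\<in>Basis. (v \<bullet> b) * g u b)" for u v
    by (subst (1) euclidean_representation[of v, symmetric]) (simp add: sum_right scaleR_right)
  have "inj A"
  proof (rule injI)
    fix u v assume "A u = A v"
    then have "g u b = g v b" if "b \<in> Basis" for b
      using A_inner that by metis
    then have "g u w = g v w" for w
      unfolding ext[of _ w] by (intro sum.cong) simp_all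
    then show "u = v" by (rule eqI)
  qed
  then have "surj A"
    using \<open>linear A\<close> linear_injective_imp_surjective by blast
  then obtain u where u: "A u = (\<Sum>b\<in>Basis. \<phi> b *\<^sub>R b)"
    by (metis surj_def)
  have "g u b = \<phi> b" if "b \<in> Basis" for b
    using that u A_inner[of b u]
    by (simp add: inner_sum_left inner_Basis if_distrib sum.delta cong: if_cong)
  then have "g u v = (\<Sum>b\<in>Basis. (v \<bullet> b) * \<phi> b)" for v
    unfolding ext[of u v] by (intro sum.cong) simp_all
  then have "g u v = \<phi> v" for v
    by (simp add: linear_expand[OF assms, of v])
  then show ?thesis
    by (intro ex1I[of _ u]) (simp_all add: eqI)
qed

text \<open>The index-raising isomorphism. \<open>tgrad\<close>, \<open>rgrad\<close>,
  \<open>christoffel\<close> and \<open>tadjoint\<close> are all definite descriptions of this form,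
  for various \<open>g\<close> and functionals.\<close>

definition sharp :: "('e \<Rightarrow> real) \<Rightarrow> 'e" where
  "sharp \<phi> = (THE u. \<forall>v. g u v = \<phi> v)"

lemma sharp: "linear \<phi> \<Longrightarrow> g (sharp \<phi>) v = \<phi> v"
  unfolding sharp_def using theI'[OF riesz, of \<phi>] by blast

lemma sharp_unique: "(\<And>v. g u v = \<phi> v) \<Longrightarrow> sharp \<phi> = u"
  unfolding sharp_def by (rule the_equality) (auto intro: eqI)

text \<open>Puts all dependence on \<open>\<phi>\<close> into scalar coefficients of fixed vectors,
  so that a varying functional can be differentiated coefficient by coefficient.\<close>

lemma sharp_expand:
  assumes "linear \<phi>"
  shows "sharp \<phi> = (\<Sum>b\<in>Basis. \<phi> b *\<^sub>R sharp (\<lambda>v. v \<bullet> b))"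
proof (rule sharp_unique)
  fix v
  have "linear (\<lambda>v::'e. v \<bullet> b)" for b
    by (simp add: bounded_linear.linear bounded_linear_inner_left)
  then have "g (\<Sum>b\<in>Basis. \<phi> b *\<^sub>R sharp (\<lambda>v. v \<bullet> b)) v = (\<Sum>b\<in>Basis. \<phi> b * (v \<bullet> b))"
    by (simp add: sum_left scaleR_left sharp)
  also have "\<dots> = \<phi> v"
    by (simp add: linear_expand[OF assms, of v] mult.commute)
  finally show "g (\<Sum>b\<in>Basis. \<phi> b *\<^sub>R sharp (\<lambda>v. v \<bullet> b)) v = \<phi> v" .
qed

text \<open>Supplies the existence behind the \<open>LEAST\<close> in \<open>lambda_min\<close>. The
  Rayleigh quotient has a minimum \<open>l\<close> on the Euclidean unit sphere, which by
  homogeneity bounds it everywhere; the form \<open>?B\<close> is then positive semidefinite with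
  value 0 at the minimiser, and \<open>psd_null_vector\<close> makes the minimiser an
  eigenvector.\<close>

lemma lambda_min_characterization:
  assumes "linear T" and self_adjoint: "\<And>v w. g (T v) w = g v (T w)"
  shows "(\<exists>v. v \<noteq> 0 \<and> T v = lambda_min T *\<^sub>R v) \<and> (\<forall>v. lambda_min T * g v v \<le> g (T v) v)"
proof -
  have T: "bounded_linear T"
    using assms(1) by (simp add: linear_conv_bounded_linear)
  let ?S = "sphere (0::'e) 1"
  let ?r = "\<lambda>v. g (T v) v / g v v"
  have "continuous_on ?S ?r"
    using eq_zero_iff
    by (intro continuous_intros continuous_on linear_continuous_on T) fastforce
  moreover have "?S \<noteq> {}"
    by simp
  ultimately obtain v0 where v0: "v0 \<in> ?S" "\<And>v. v \<in> ?S \<Longrightarrow> ?r v0 \<le> ?r v"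
    using continuous_attains_inf[of ?S ?r] by auto
  define l where "l = ?r v0"
  have lower: "l * g v v \<le> g (T v) v" for v
  proof (cases "v = 0")
    case True
    then show ?thesis by (simp add: zero_left zero_right)
  next
    case False
    then have "l \<le> ?r (v /\<^sub>R norm v)"
      unfolding l_def by (intro v0(2)) simp
    also have "\<dots> = ?r v"
      using False by (simp add: linear_scale[OF assms(1)] scaleR_left scaleR_right)
    finally show ?thesis
      using positive[OF False] by (simp add: pos_le_divide_eq)
  qed
  have "v0 \<noteq> 0" using v0 by auto
  let ?B = "\<lambda>v w. g (T v) w - l * g v w"
  have "bilinear ?B"
    unfolding bilinear_def
    by (intro conjI allI linearI)
       (auto simp: linear_add[OF assms(1)] linear_scale[OF assms(1)] add_left add_right
          scaleR_left scaleR_right algebra_simps)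
  then have "?B v0 w = 0" for w
  proof (rule psd_null_vector)
    show "?B v w = ?B w v" for v w
      using commute self_adjoint by metis
    show "?B v v \<ge> 0" for v
      using lower[of v] by simp
    show "?B v0 v0 = 0"
      using eq_zero_iff[of v0] \<open>v0 \<noteq> 0\<close> by (simp add: l_def)
  qed
  then have eig: "T v0 = l *\<^sub>R v0"
    by (intro eqI) (simp add: scaleR_left)
  have "lambda_min T = l"
    unfolding lambda_min_def
  proof (rule Least_equality)
    show "\<exists>v. v \<noteq> 0 \<and> T v = l *\<^sub>R v"
      using eig \<open>v0 \<noteq> 0\<close> by blast
    fix m assume "\<exists>v. v \<noteq> 0 \<and> T v = m *\<^sub>R v"
    then obtain v where "v \<noteq> 0" "T v = m *\<^sub>R v" by blast
    then show "l \<le> m"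
      using lower[of v] positive[of v] by (simp add: scaleR_left)
  qed
  then show ?thesis
    using lower eig \<open>v0 \<noteq> 0\<close> by blast
qed

lemma lambda_min_le:
  assumes "linear T" and "\<And>v w. g (T v) w = g v (T w)"
  shows "lambda_min T * g v v \<le> g (T v) v"
  using lambda_min_characterization[OF assms] by blast

lemma lambda_min_ge:
  assumes "linear T" and "\<And>v w. g (T v) w = g v (T w)" and "\<And>v. l * g v v \<le> g (T v) v"
  shows "l \<le> lambda_min T"
proof -
  obtain v where v: "v \<noteq> 0" "T v = lambda_min T *\<^sub>R v"
    using lambda_min_characterization[OF assms(1,2)] by blast
  have "g (T v) v = lambda_min T * g v v"
    by (subst v(2)) (simp add: scaleR_left)
  then show ?thesis
    using assms(3)[of v] positive[OF v(1)] by simp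
qed

section \<open>Derivatives of the quadratic form and of powers of its norm\<close>

lemma has_derivative_form: "((\<lambda>v. g v v) has_derivative (\<lambda>w. 2 * g v w)) (at v)"
proof -
  have "((\<lambda>v. g v v) has_derivative (\<lambda>w. g v w + g w v)) (at v)"
    using FDERIV[OF has_derivative_ident has_derivative_ident] .
  moreover have "(\<lambda>w. g v w + g w v) = (\<lambda>w. 2 * g v w)"
  proof
    show "g v w + g w v = 2 * g v w" for w
      using commute[of v w] by simp
  qed
  ultimately show ?thesis by simp
qed

text \<open>The cube is \<open>t * sqrt t\<close> with \<open>t = g v v\<close>; this is differentiable also at the origin, where
  \<open>nrm\<close> is not.\<close>

lemma has_derivative_nrm_cube:
  "((\<lambda>v. nrm v ^ 3) has_derivative (\<lambda>w. 3 * nrm v * g v w)) (at v)"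
proof -
  have cube: "((\<lambda>t. t * sqrt t) has_real_derivative 3 / 2 * sqrt t) (at t)" if "t \<ge> 0" for t
  proof (cases "t = 0")
    case True
    have "(\<lambda>h. (h * sqrt h) / h) \<midarrow>0\<rightarrow> 0"
    proof (rule Lim_transform_eventually)
      show "sqrt \<midarrow>0\<rightarrow> 0"
        using isCont_real_sqrt[of 0] by (simp add: isCont_def)
      show "\<forall>\<^sub>F h in at 0. sqrt h = (h * sqrt h) / h"
        by (auto simp: eventually_at_filter)
    qed
    then show ?thesis
      using True by (simp add: DERIV_def)
  next
    case False
    with that have "t > 0" by simp
    then show ?thesis
      by (auto intro!: derivative_eq_intros simp: field_simps)
  qed
  from has_derivative_compose[OF has_derivative_form
      cube[OF nonneg, unfolded has_field_derivative_def]]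
  have "((\<lambda>v. g v v * sqrt (g v v)) has_derivative
      (\<lambda>w. 3 / 2 * sqrt (g v v) * (2 * g v w))) (at v)" .
  then show ?thesis
    using nonneg by (simp add: nrm_def power3_eq_cube mult_ac)
qed

text \<open>\<open>nrm v *\<^sub>R v\<close> is the gradient of \<open>nrm v ^ 3 / 3\<close>, so
  this yields the Hessian of the cubic term. The formula is right at the origin too: the derivative
  there is zero, and so are both terms, the second because of its factor \<open>v\<close>.\<close>

lemma has_derivative_nrm_scaleR:
  "((\<lambda>v. nrm v *\<^sub>R v) has_derivative (\<lambda>w. nrm v *\<^sub>R w + (g v w / nrm v) *\<^sub>R v)) (at v)"
proof (cases "v = 0")
  case True
  \<comment> \<open>Boundedness of \<open>g\<close> compares \<open>nrm\<close> with the Euclidean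
    norm, in which differentiability is measured.\<close>
  obtain K where "\<And>v w. norm (g v w) \<le> norm v * norm w * K"
    using pos_bounded by blast
  then have K: "g v v \<le> norm v * norm v * K" for v
    by (metis abs_le_D1 real_norm_def)
  have "nrm w \<le> norm w * sqrt K" for w
    using real_sqrt_le_mono[OF K, of w] by (simp add: nrm_def real_sqrt_mult)
  moreover have "((\<lambda>w::'e. norm w * sqrt K) \<longlongrightarrow> 0) (at 0)"
    by (auto intro!: tendsto_eq_intros)
  ultimately have "(nrm \<longlongrightarrow> 0) (at 0)"
    by (intro tendsto_sandwich[of "\<lambda>_. 0" nrm "at 0" "\<lambda>w. norm w * sqrt K" 0]) simp_all
  moreover have "\<forall>\<^sub>F w in at 0. nrm w = norm (nrm w *\<^sub>R w) / norm w"
    by (simp add: eventually_at_filter)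
  ultimately have "((\<lambda>w. norm (nrm w *\<^sub>R w) / norm w) \<longlongrightarrow> 0) (at 0)"
    by (rule Lim_transform_eventually)
  then have "((\<lambda>v. nrm v *\<^sub>R v) has_derivative (\<lambda>w. 0)) (at 0)"
    unfolding has_derivative_at by (intro conjI bounded_linear_zero) simp
  then show ?thesis
    using True by simp
next
  case False
  then have "(sqrt has_real_derivative inverse (sqrt (g v v)) / 2) (at (g v v))"
    by (intro DERIV_real_sqrt positive)
  then have "(sqrt has_derivative (*) (inverse (sqrt (g v v)) / 2)) (at (g v v))"
    by (simp add: has_field_derivative_def)
  from has_derivative_compose[OF has_derivative_form this]
  have "((\<lambda>v. sqrt (g v v)) has_derivative (\<lambda>w. g v w / sqrt (g v v))) (at v)"
    by (rule has_derivative_eq_rhs) (simp add: inverse_eq_divide)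
  then have "(nrm has_derivative (\<lambda>w. g v w / nrm v)) (at v)"
    unfolding nrm_def[abs_def] .
  from has_derivative_scaleR[OF this has_derivative_ident] show ?thesis .
qed

end

section \<open>Second derivatives\<close>

text \<open>A pointwise notion in the directional style of \<open>C_on\<close>, without continuity
  of second derivatives; symmetry and the second-order chain rule are proved from it
  directly.\<close>

definition twice_differentiable_at ::
  "('a::euclidean_space \<Rightarrow> 'b::real_normed_vector) \<Rightarrow> 'a \<Rightarrow> bool" where
  "twice_differentiable_at h x \<longleftrightarrow>
     (\<forall>\<^sub>F y in nhds x. h differentiable (at y)) \<and>
     (\<forall>v. (\<lambda>y. frechet_derivative h (at y) v) differentiable (at x))"

definition second_derivative ::
  "('a::euclidean_space \<Rightarrow> 'b::real_normed_vector) \<Rightarrow> 'a \<Rightarrow> 'a \<Rightarrow> 'a \<Rightarrow> 'b" where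
  "second_derivative h x v w = frechet_derivative (\<lambda>y. frechet_derivative h (at y) w) (at x) v"

lemma C_on_imp_differentiable:
  "C_on (Suc k) h S \<Longrightarrow> x \<in> S \<Longrightarrow> h differentiable (at x)"
  by simp

lemma C_on_imp_twice_differentiable:
  "C_on 2 h S \<Longrightarrow> open S \<Longrightarrow> x \<in> S \<Longrightarrow> twice_differentiable_at h x"
  by (auto simp: twice_differentiable_at_def numeral_2_eq_2 eventually_nhds)

lemma smooth_on_imp_differentiable:
  "smooth_on h S \<Longrightarrow> x \<in> S \<Longrightarrow> h differentiable (at x)"
  unfolding smooth_on_def using C_on_imp_differentiable by blast

lemma smooth_on_imp_twice_differentiable:
  "smooth_on h S \<Longrightarrow> open S \<Longrightarrow> x \<in> S \<Longrightarrow> twice_differentiable_at h x"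
  unfolding smooth_on_def using C_on_imp_twice_differentiable by blast

lemma has_derivative_cong_nhds:
  assumes "\<forall>\<^sub>F y in nhds x. h y = k y"
  shows "(h has_derivative D) (at x) \<longleftrightarrow> (k has_derivative D) (at x)"
proof -
  have "h x = k x" "\<forall>\<^sub>F y in at x. h y = k y" "\<forall>\<^sub>F y in at x. k y = h y"
    using assms by (auto dest: eventually_nhds_x_imp_x simp: eventually_at_filter elim: eventually_mono)
  then show ?thesis
    using has_derivative_transform_eventually[of h D x UNIV k]
      has_derivative_transform_eventually[of k D x UNIV h] by auto
qed

lemma frechet_derivative_cong:
  assumes "\<forall>\<^sub>F y in nhds x. h y = k y"
  shows "frechet_derivative h (at x) = frechet_derivative k (at x)"
  unfolding frechet_derivative_def has_derivative_cong_nhds[OF assms] ..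

lemma differentiable_cong:
  assumes "\<forall>\<^sub>F y in nhds x. h y = k y"
  shows "h differentiable (at x) \<longleftrightarrow> k differentiable (at x)"
  unfolding differentiable_def has_derivative_cong_nhds[OF assms] ..

lemma twice_differentiable_at_cong:
  assumes "\<forall>\<^sub>F y in nhds x. h y = k y"
  shows "twice_differentiable_at h x \<longleftrightarrow> twice_differentiable_at k x"
    and "second_derivative h x = second_derivative k x"
proof -
  \<comment> \<open>Agreement near \<open>x\<close> is agreement near every \<open>y\<close> close
    to \<open>x\<close>, so the first derivatives agree near \<open>x\<close> as well.\<close>
  have ev: "\<forall>\<^sub>F y in nhds x. \<forall>\<^sub>F z in nhds y. h z = k z"
    using assms by (simp add: eventually_eventually)
  then have D: "\<forall>\<^sub>F y in nhds x. frechet_derivative h (at y) v = frechet_derivative k (at y) v" for v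
    by (rule eventually_mono) (metis frechet_derivative_cong)
  have "\<forall>\<^sub>F y in nhds x. h differentiable (at y) \<longleftrightarrow> k differentiable (at y)"
    using ev by (rule eventually_mono) (rule differentiable_cong)
  then have "(\<forall>\<^sub>F y in nhds x. h differentiable (at y)) \<longleftrightarrow> (\<forall>\<^sub>F y in nhds x. k differentiable (at y))"
    by (rule eventually_subst)
  then show "twice_differentiable_at h x \<longleftrightarrow> twice_differentiable_at k x"
    unfolding twice_differentiable_at_def using differentiable_cong[OF D] by simp
  show "second_derivative h x = second_derivative k x"
    unfolding second_derivative_def using frechet_derivative_cong[OF D] by (simp add: fun_eq_iff)
qed

lemma twice_differentiable_imp_differentiable:
  "twice_differentiable_at h x \<Longrightarrow> h differentiable (at x)"
  unfolding twice_differentiable_at_def by (auto dest: eventually_nhds_x_imp_x)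

lemma has_second_derivative:
  "twice_differentiable_at h x \<Longrightarrow>
    ((\<lambda>y. frechet_derivative h (at y) w) has_derivative (\<lambda>v. second_derivative h x v w)) (at x)"
  unfolding twice_differentiable_at_def second_derivative_def
  using frechet_derivative_works by fastforce

lemma linear_second_derivative:
  "twice_differentiable_at h x \<Longrightarrow> linear (\<lambda>v. second_derivative h x v w)"
  using has_second_derivative has_derivative_linear by blast

text \<open>By the mean value theorem in the direction \<open>v\<close>, the second difference quotient tends to the
  derivative along \<open>w\<close> of the derivative along \<open>v\<close>; the quotient is symmetric in \<open>v\<close> and \<open>w\<close>.\<close>

lemma second_difference_quotient:
  fixes h :: "'a::euclidean_space \<Rightarrow> real"
  assumes h: "twice_differentiable_at h x"
  shows "((\<lambda>t. (h (x + t *\<^sub>R v + t *\<^sub>R w) - h (x + t *\<^sub>R v) - h (x + t *\<^sub>R w) + h x) / t\<^sup>2)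
    \<longlongrightarrow> second_derivative h x w v) (at_right 0)"
proof (rule tendstoI)
  fix e :: real assume "e > 0"
  define N where "N = norm v + norm w + 1"
  have N: "N > 0" "norm v \<le> N" "norm w \<le> N" "norm v + norm w < N"
    by (auto simp: N_def add_pos_nonneg intro: add_nonneg_pos)
  \<comment> \<open>Two linearisation errors of size \<open>e' * (t * N)\<close>, divided by
    \<open>t\<close>, then add up to \<open>e / 2\<close>.\<close>
  define e' where "e' = e / (4 * N)"
  have "e' > 0" using \<open>e > 0\<close> N by (simp add: e'_def)
  let ?\<phi> = "\<lambda>y. frechet_derivative h (at y) v" and ?\<phi>' = "\<lambda>u. second_derivative h x u v"
  have \<phi>: "(?\<phi> has_derivative ?\<phi>') (at x)"
    using h by (rule has_second_derivative)
  then have lin: "linear ?\<phi>'" by (rule has_derivative_linear)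
  obtain d1 where d1: "d1 > 0"
    "\<And>y. norm (y - x) < d1 \<Longrightarrow> norm (?\<phi> y - ?\<phi> x - ?\<phi>' (y - x)) \<le> e' * norm (y - x)"
    using \<phi> \<open>e' > 0\<close> unfolding has_derivative_at_alt by blast
  obtain d2 where d2: "d2 > 0" "\<And>y. dist y x < d2 \<Longrightarrow> h differentiable (at y)"
    using h unfolding twice_differentiable_at_def eventually_nhds_metric by blast
  define d where "d = min d1 d2 / N"
  have "d > 0" using d1 d2 N by (simp add: d_def)
  have "dist ((h (x + t *\<^sub>R v + t *\<^sub>R w) - h (x + t *\<^sub>R v) - h (x + t *\<^sub>R w) + h x) / t\<^sup>2)
      (second_derivative h x w v) < e" if t: "0 < t" "t < d" for t
  proof -
    have tN: "t * N < min d1 d2"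
      using t N by (simp add: d_def pos_less_divide_eq)
    have small: "norm (\<xi> *\<^sub>R v + \<eta> *\<^sub>R w) \<le> t * N" if "0 \<le> \<xi>" "\<xi> \<le> t" "0 \<le> \<eta>" "\<eta> \<le> t" for \<xi> \<eta>
    proof -
      have "norm (\<xi> *\<^sub>R v + \<eta> *\<^sub>R w) \<le> \<xi> * norm v + \<eta> * norm w"
        using that by (metis norm_triangle_le norm_scaleR abs_of_nonneg order_refl)
      also have "\<dots> \<le> t * norm v + t * norm w"
        using that by (intro add_mono mult_right_mono) auto
      also have "\<dots> \<le> t * N"
        using t N by (simp add: distrib_left[symmetric])
      finally show ?thesis .
    qed
    have diff: "h differentiable (at (x + \<xi> *\<^sub>R v + \<eta> *\<^sub>R w))"
      if "0 \<le> \<xi>" "\<xi> \<le> t" "0 \<le> \<eta>" "\<eta> \<le> t" for \<xi> \<eta>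
      using small[OF that] tN by (intro d2) (simp add: dist_norm)
    define p where "p \<tau> = h (x + \<tau> *\<^sub>R v + t *\<^sub>R w) - h (x + \<tau> *\<^sub>R v)" for \<tau>
    have p': "(p has_real_derivative ?\<phi> (x + \<xi> *\<^sub>R v + t *\<^sub>R w) - ?\<phi> (x + \<xi> *\<^sub>R v)) (at \<xi>)"
      if "0 \<le> \<xi>" "\<xi> \<le> t" for \<xi>
    proof -
      have part: "((\<lambda>\<tau>. h (x + \<tau> *\<^sub>R v + \<eta> *\<^sub>R w)) has_real_derivative
          ?\<phi> (x + \<xi> *\<^sub>R v + \<eta> *\<^sub>R w)) (at \<xi>)"
        if "0 \<le> \<eta>" "\<eta> \<le> t" for \<eta>
      proof -
        let ?D = "frechet_derivative h (at (x + \<xi> *\<^sub>R v + \<eta> *\<^sub>R w))"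
        have D: "(h has_derivative ?D) (at (x + \<xi> *\<^sub>R v + \<eta> *\<^sub>R w))"
          using diff[OF \<open>0 \<le> \<xi>\<close> \<open>\<xi> \<le> t\<close> that] frechet_derivative_works by blast
        have "((\<lambda>\<tau>. x + \<tau> *\<^sub>R v + \<eta> *\<^sub>R w) has_derivative (\<lambda>s. s *\<^sub>R v)) (at \<xi>)"
          by (auto intro!: derivative_eq_intros)
        from has_derivative_compose[OF this D]
        have "((\<lambda>\<tau>. h (x + \<tau> *\<^sub>R v + \<eta> *\<^sub>R w)) has_derivative (\<lambda>s. ?D (s *\<^sub>R v))) (at \<xi>)" .
        moreover have "(\<lambda>s. ?D (s *\<^sub>R v)) = (*) (?D v)"
          using linear_scale[OF has_derivative_linear[OF D]] by (simp add: fun_eq_iff mult.commute)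
        ultimately show ?thesis
          by (simp add: has_field_derivative_def)
      qed
      show ?thesis
        unfolding p_def using DERIV_diff[OF part[of t] part[of 0]] t by simp
    qed
    obtain \<xi> where \<xi>: "0 < \<xi>" "\<xi> < t"
      "p t - p 0 = (t - 0) * (?\<phi> (x + \<xi> *\<^sub>R v + t *\<^sub>R w) - ?\<phi> (x + \<xi> *\<^sub>R v))"
      using MVT2[OF t(1), of p, OF p'] by auto
    \<comment> \<open>Both points lie within \<open>t * N\<close> of \<open>x\<close> and differ by
      \<open>t *\<^sub>R w\<close>, so linearising at \<open>x\<close> leaves exactly
      \<open>t * ?\<phi>' w\<close>.\<close>
    define y z where "y = x + \<xi> *\<^sub>R v + t *\<^sub>R w" and "z = x + \<xi> *\<^sub>R v"
    have yz: "norm (y - x) \<le> t * N" "norm (z - x) \<le> t * N"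
      using small[of \<xi> t] small[of \<xi> 0] \<xi> t by (auto simp: y_def z_def)
    have y: "norm (?\<phi> y - ?\<phi> x - ?\<phi>' (y - x)) \<le> e' * (t * N)"
      using d1(2)[of y] yz(1) tN \<open>e' > 0\<close>
      by (meson less_imp_le min_less_iff_conj mult_left_mono order_le_less_trans order_trans)
    have z: "norm (?\<phi> z - ?\<phi> x - ?\<phi>' (z - x)) \<le> e' * (t * N)"
      using d1(2)[of z] yz(2) tN \<open>e' > 0\<close>
      by (meson less_imp_le min_less_iff_conj mult_left_mono order_le_less_trans order_trans)
    have "?\<phi>' (y - x) - ?\<phi>' (z - x) = t * ?\<phi>' w"
      by (simp add: y_def z_def linear_add[OF lin] linear_scale[OF lin])
    then have "\<bar>?\<phi> y - ?\<phi> z - t * ?\<phi>' w\<bar> \<le> 2 * (e' * (t * N))"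
      using y z by simp
    have "p t - p 0 = t * (?\<phi> y - ?\<phi> z)"
      using \<xi> by (simp add: y_def z_def)
    moreover have "h (x + t *\<^sub>R v + t *\<^sub>R w) - h (x + t *\<^sub>R v) - h (x + t *\<^sub>R w) + h x = p t - p 0"
      by (simp add: p_def)
    ultimately have "(h (x + t *\<^sub>R v + t *\<^sub>R w) - h (x + t *\<^sub>R v) - h (x + t *\<^sub>R w) + h x) / t\<^sup>2
        - ?\<phi>' w = (?\<phi> y - ?\<phi> z - t * ?\<phi>' w) / t"
      using t by (simp add: power2_eq_square diff_divide_distrib)
    with t \<open>\<bar>?\<phi> y - ?\<phi> z - t * ?\<phi>' w\<bar> \<le> 2 * (e' * (t * N))\<close>
    have "\<bar>(h (x + t *\<^sub>R v + t *\<^sub>R w) - h (x + t *\<^sub>R v) - h (x + t *\<^sub>R w) + h x) / t\<^sup>2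
        - ?\<phi>' w\<bar> \<le> 2 * (e' * N)"
      by (simp add: pos_divide_le_eq mult_ac)
    also have "\<dots> < e"
      using \<open>e > 0\<close> N by (simp add: e'_def)
    finally show ?thesis
      by (simp add: dist_real_def)
  qed
  then show "\<forall>\<^sub>F t in at_right 0. dist ((h (x + t *\<^sub>R v + t *\<^sub>R w) - h (x + t *\<^sub>R v)
      - h (x + t *\<^sub>R w) + h x) / t\<^sup>2) (second_derivative h x w v) < e"
    using \<open>d > 0\<close> by (auto simp: eventually_at_right_field)
qed

lemma second_derivative_symmetric:
  fixes h :: "'a::euclidean_space \<Rightarrow> real"
  assumes "twice_differentiable_at h x"
  shows "second_derivative h x v w = second_derivative h x w v"
proof -
  have "h (x + t *\<^sub>R w + t *\<^sub>R v) - h (x + t *\<^sub>R w) - h (x + t *\<^sub>R v) + h x =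
      h (x + t *\<^sub>R v + t *\<^sub>R w) - h (x + t *\<^sub>R v) - h (x + t *\<^sub>R w) + h x" for t
    by (simp add: algebra_simps)
  with second_difference_quotient[OF assms, of w v]
  have "((\<lambda>t. (h (x + t *\<^sub>R v + t *\<^sub>R w) - h (x + t *\<^sub>R v) - h (x + t *\<^sub>R w) + h x) / t\<^sup>2)
      \<longlongrightarrow> second_derivative h x v w) (at_right 0)"
    by simp
  then show ?thesis
    using second_difference_quotient[OF assms, of v w] tendsto_unique[OF trivial_limit_at_right_real]
    by blast
qed

text \<open>Linearity in the first argument is that of a derivative; symmetry carries it to the
  second.\<close>

lemma bilinear_second_derivative:
  fixes h :: "'a::euclidean_space \<Rightarrow> real"
  assumes "twice_differentiable_at h x"
  shows "bilinear (second_derivative h x)"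
  unfolding bilinear_def
  by (subst (1) second_derivative_symmetric[OF assms, abs_def])
     (intro conjI allI linear_second_derivative assms)

lemma frechet_derivative_chain:
  assumes "\<psi> differentiable (at x)" and "F differentiable (at (\<psi> x))"
  shows "frechet_derivative (\<lambda>y. F (\<psi> y)) (at x) v =
    frechet_derivative F (at (\<psi> x)) (frechet_derivative \<psi> (at x) v)"
  using frechet_derivative_compose[OF assms] by (simp add: o_def)

text \<open>Second-order chain rule. In the first derivative both the linear map and its argument
  vary with \<open>y\<close>; expansion in \<open>Basis\<close> turns it into a finite sum of
  products of real functions. The term with \<open>second_derivative \<psi>\<close> is the one that
  later produces a Christoffel symbol.\<close>

lemma twice_differentiable_compose:
  fixes F :: "'b::euclidean_space \<Rightarrow> real"
  assumes \<psi>: "twice_differentiable_at \<psi> x" and F: "twice_differentiable_at F (\<psi> x)"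
  shows "twice_differentiable_at (\<lambda>y. F (\<psi> y)) x"
    and "second_derivative (\<lambda>y. F (\<psi> y)) x v w =
      second_derivative F (\<psi> x) (frechet_derivative \<psi> (at x) v) (frechet_derivative \<psi> (at x) w) +
      frechet_derivative F (at (\<psi> x)) (second_derivative \<psi> x v w)"
proof -
  have \<psi>x: "\<psi> differentiable (at x)" and Fx: "F differentiable (at (\<psi> x))"
    using \<psi> F twice_differentiable_imp_differentiable by auto
  have "filterlim \<psi> (nhds (\<psi> x)) (nhds x)"
    using differentiable_imp_continuous_within[OF \<psi>x]
    by (simp add: continuous_within tendsto_at_iff_tendsto_nhds)
  then have "\<forall>\<^sub>F y in nhds x. F differentiable (at (\<psi> y))"
    using F unfolding twice_differentiable_at_def filterlim_iff by blast
  then have ev: "\<forall>\<^sub>F y in nhds x. \<psi> differentiable (at y) \<and> F differentiable (at (\<psi> y))"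
    using \<psi> unfolding twice_differentiable_at_def by (auto elim: eventually_elim2)
  have expand: "\<forall>\<^sub>F y in nhds x. frechet_derivative (\<lambda>y. F (\<psi> y)) (at y) w =
      (\<Sum>b\<in>Basis. (frechet_derivative \<psi> (at y) w \<bullet> b) * frechet_derivative F (at (\<psi> y)) b)" for w
    using ev
  proof eventually_elim
    case (elim y)
    then have "linear (frechet_derivative F (at (\<psi> y)))"
      by (simp add: linear_frechet_derivative)
    from linear_expand[OF this, of "frechet_derivative \<psi> (at y) w"] show ?case
      using elim by (simp add: frechet_derivative_chain)
  qed
  let ?D2 = "\<lambda>v w. \<Sum>b\<in>Basis.
      (frechet_derivative \<psi> (at x) w \<bullet> b) *
        second_derivative F (\<psi> x) (frechet_derivative \<psi> (at x) v) b +
      (second_derivative \<psi> x v w \<bullet> b) * frechet_derivative F (at (\<psi> x)) b"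
  have \<psi>': "(\<psi> has_derivative frechet_derivative \<psi> (at x)) (at x)"
    using \<psi>x frechet_derivative_works by blast
  have "((\<lambda>y. \<Sum>b\<in>Basis. (frechet_derivative \<psi> (at y) w \<bullet> b) *
      frechet_derivative F (at (\<psi> y)) b) has_derivative (\<lambda>v. ?D2 v w)) (at x)" for w
    by (intro has_derivative_sum has_derivative_mult has_derivative_inner_left
        has_second_derivative[OF \<psi>] has_derivative_compose[OF \<psi>' has_second_derivative[OF F]])
  then have D2: "((\<lambda>y. frechet_derivative (\<lambda>y. F (\<psi> y)) (at y) w) has_derivative
      (\<lambda>v. ?D2 v w)) (at x)" for w
    unfolding has_derivative_cong_nhds[OF expand] .
  then have "(\<lambda>y. frechet_derivative (\<lambda>y. F (\<psi> y)) (at y) w) differentiable (at x)" for w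
    by (rule differentiableI)
  moreover have "\<forall>\<^sub>F y in nhds x. (\<lambda>y. F (\<psi> y)) differentiable (at y)"
    using ev by (rule eventually_mono) (use differentiable_chain_at[unfolded o_def] in blast)
  ultimately show "twice_differentiable_at (\<lambda>y. F (\<psi> y)) x"
    unfolding twice_differentiable_at_def by (intro conjI allI)
  have "second_derivative (\<lambda>y. F (\<psi> y)) x v w = ?D2 v w"
    unfolding second_derivative_def frechet_derivative_at[OF D2[of w], symmetric] ..
  also have "\<dots> = second_derivative F (\<psi> x) (frechet_derivative \<psi> (at x) v) (frechet_derivative \<psi> (at x) w)
      + frechet_derivative F (at (\<psi> x)) (second_derivative \<psi> x v w)"
  proof -
    have "linear (second_derivative F (\<psi> x) u)" for u
      using bilinear_second_derivative[OF F] by (simp add: bilinear_def)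
    then show ?thesis
      by (simp add: sum.distrib
          linear_expand[of "second_derivative F (\<psi> x) _" "frechet_derivative \<psi> (at x) w"]
          linear_expand[OF linear_frechet_derivative[OF Fx], of "second_derivative \<psi> x v w"])
  qed
  finally show "second_derivative (\<lambda>y. F (\<psi> y)) x v w =
      second_derivative F (\<psi> x) (frechet_derivative \<psi> (at x) v) (frechet_derivative \<psi> (at x) w) +
      frechet_derivative F (at (\<psi> x)) (second_derivative \<psi> x v w)" .
qed

text \<open>On a single tangent space the inner product does not vary with the point, so the vectors
  in \<open>sharp_expand\<close> are constant and only the coefficients are differentiated.\<close>

lemma (in inner_form) has_derivative_gradient:
  assumes "twice_differentiable_at h x"
  shows "((\<lambda>y. sharp (frechet_derivative h (at y))) has_derivative
    (\<lambda>v. sharp (second_derivative h x v))) (at x)"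
proof -
  let ?e = "\<lambda>b. sharp (\<lambda>v. v \<bullet> b)"
  have "\<forall>\<^sub>F y in nhds x. sharp (frechet_derivative h (at y)) =
      (\<Sum>b\<in>Basis. frechet_derivative h (at y) b *\<^sub>R ?e b)"
    using assms unfolding twice_differentiable_at_def
    by (auto elim!: eventually_mono intro!: sharp_expand linear_frechet_derivative)
  moreover have "((\<lambda>y. \<Sum>b\<in>Basis. frechet_derivative h (at y) b *\<^sub>R ?e b) has_derivative
      (\<lambda>v. \<Sum>b\<in>Basis. second_derivative h x v b *\<^sub>R ?e b)) (at x)"
    by (intro has_derivative_sum has_derivative_scaleR_left has_second_derivative assms)
  moreover have "sharp (second_derivative h x v) = (\<Sum>b\<in>Basis. second_derivative h x v b *\<^sub>R ?e b)" for v
    using bilinear_second_derivative[OF assms] by (intro sharp_expand) (simp add: bilinear_def)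
  ultimately show ?thesis
    by (simp add: has_derivative_cong_nhds)
qed

text \<open>With \<open>E u z\<close> representing \<open>g u z - g x z\<close>, the increment \<open>z = G u - G x\<close> solves
  \<open>z = Q u - E u z\<close>, where \<open>E\<close> tends to zero and \<open>Q\<close> is differentiable with \<open>Q x = 0\<close>.\<close>

lemma differentiable_representative:
  fixes G :: "'a::euclidean_space \<Rightarrow> 'e::euclidean_space" and g :: "'a \<Rightarrow> 'e \<Rightarrow> 'e \<Rightarrow> real"
  assumes S: "open S" "x \<in> S"
    and inner: "\<And>u. u \<in> S \<Longrightarrow> inner_form (g u)"
    and G: "\<And>u w. u \<in> S \<Longrightarrow> g u (G u) w = \<phi> u w"
    and g': "\<And>v w. (\<lambda>u. g u v w) differentiable (at x)"
    and \<phi>': "\<And>w. (\<lambda>u. \<phi> u w) differentiable (at x)"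
  shows "G differentiable (at x)"
proof -
  interpret x: inner_form "g x" using inner S by blast
  let ?e = "\<lambda>b::'e. x.sharp (\<lambda>v. v \<bullet> b)"
  \<comment> \<open>\<open>Q\<close> contains only the fixed vector \<open>G x\<close>, so it is
    differentiable by the hypotheses on \<open>g\<close> and \<open>\<phi>\<close> while nothing is
    known yet about \<open>G\<close>.\<close>
  define Q where "Q u = (\<Sum>b\<in>Basis. (\<phi> u b - g u (G x) b) *\<^sub>R ?e b)" for u
  define E where "E u z = (\<Sum>b\<in>Basis. (g u z b - g x z b) *\<^sub>R ?e b)" for u z
  define \<eta> where "\<eta> u = (\<Sum>b\<in>Basis. \<Sum>c\<in>Basis. \<bar>g u c b - g x c b\<bar> * norm (?e b))" for u
  have expand: "x.sharp f = (\<Sum>b\<in>Basis. f b *\<^sub>R ?e b)" if "linear f" for f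
    using that by (rule x.sharp_expand)
  have "Q differentiable (at x)"
    unfolding Q_def
    by (intro differentiable_sum ballI differentiable_scaleR differentiable_diff g' \<phi>') simp_all
  then obtain Q' where Q': "(Q has_derivative Q') (at x)"
    unfolding differentiable_def by blast
  have "Q x = 0"
    using G S by (simp add: Q_def)
  have fixpoint: "G u - G x = Q u - E u (G u - G x)" if "u \<in> S" for u
  proof -
    interpret u: inner_form "g u" using inner that by blast
    let ?z = "G u - G x"
    have lin: "linear (g y z)" if "y = u \<or> y = x" for y z
      using that u.bilinear x.bilinear by (auto simp: bilinear_def)
    have "?z = x.sharp (g x ?z)"
      by (rule x.sharp_unique[symmetric]) simp
    also have "\<dots> = (\<Sum>b\<in>Basis. g x ?z b *\<^sub>R ?e b)"
      by (rule expand) (simp add: lin)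
    also have "\<dots> = Q u - E u ?z"
      unfolding Q_def E_def using G[OF that]
      by (simp add: sum_subtractf[symmetric] scaleR_diff_left[symmetric] u.diff_left)
    finally show ?thesis .
  qed
  have E: "norm (E u z) \<le> \<eta> u * norm z" if "u \<in> S" for u z
  proof -
    interpret u: inner_form "g u" using inner that by blast
    have lin: "linear (\<lambda>z. g u z b - g x z b)" for b
      using u.bilinear x.bilinear by (auto simp: bilinear_def intro: linear_compose_sub)
    have "norm (E u z) \<le> (\<Sum>b\<in>Basis. norm ((g u z b - g x z b) *\<^sub>R ?e b))"
      unfolding E_def by (rule norm_sum)
    also have "\<dots> \<le> (\<Sum>b\<in>Basis. (\<Sum>c\<in>Basis. \<bar>g u c b - g x c b\<bar> * norm (?e b)) * norm z)"
    proof (rule sum_mono)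
      fix b :: 'e
      have "\<bar>g u z b - g x z b\<bar> = \<bar>\<Sum>c\<in>Basis. (z \<bullet> c) * (g u c b - g x c b)\<bar>"
        using linear_expand[OF lin[of b], of z] by simp
      also have "\<dots> \<le> (\<Sum>c\<in>Basis. \<bar>z \<bullet> c\<bar> * \<bar>g u c b - g x c b\<bar>)"
        unfolding abs_mult[symmetric] by (rule sum_abs)
      also have "\<dots> \<le> (\<Sum>c\<in>Basis. norm z * \<bar>g u c b - g x c b\<bar>)"
        by (intro sum_mono mult_right_mono Basis_le_norm) auto
      finally have "\<bar>g u z b - g x z b\<bar> \<le> norm z * (\<Sum>c\<in>Basis. \<bar>g u c b - g x c b\<bar>)"
        by (simp add: sum_distrib_left)
      then have "\<bar>g u z b - g x z b\<bar> * norm (?e b)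
          \<le> norm z * (\<Sum>c\<in>Basis. \<bar>g u c b - g x c b\<bar>) * norm (?e b)"
        by (rule mult_right_mono) simp
      then show "norm ((g u z b - g x z b) *\<^sub>R ?e b)
          \<le> (\<Sum>c\<in>Basis. \<bar>g u c b - g x c b\<bar> * norm (?e b)) * norm z"
        by (simp add: sum_distrib_left mult_ac)
    qed
    finally show ?thesis
      by (simp add: \<eta>_def sum_distrib_right)
  qed
  have "((\<lambda>u. g u v w) \<longlongrightarrow> g x v w) (at x)" for v w
    using differentiable_imp_continuous_within[OF g'] by (simp add: continuous_within)
  then have "((\<lambda>u. \<bar>g u v w - g x v w\<bar>) \<longlongrightarrow> 0) (at x)" for v w
    by (simp add: LIM_zero tendsto_rabs_zero)
  then have "(\<eta> \<longlongrightarrow> (\<Sum>b::'e\<in>Basis. \<Sum>c::'e\<in>Basis. 0 * norm (?e b))) (at x)"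
    unfolding \<eta>_def by (intro tendsto_intros)
  then have \<eta>: "(\<eta> \<longlongrightarrow> 0) (at x)"
    by simp
  \<comment> \<open>Where \<open>\<eta> u < 1 / 2\<close>, the fixed-point equation gives
    \<open>norm (G u - G x) \<le> 2 * norm (Q u)\<close>. The deviation from \<open>Q u\<close> is
    then at most \<open>\<eta> u\<close> times a quantity of order \<open>u - x\<close>, hence
    negligible, and \<open>G\<close> inherits the derivative of \<open>Q\<close>.\<close>
  have bound: "norm (G u - G x - Q u) \<le> 2 * \<eta> u * norm (Q u)" if "u \<in> S" "\<eta> u < 1 / 2" for u
  proof -
    let ?z = "G u - G x"
    have eq: "?z - Q u = - E u ?z"
      using fixpoint[OF that(1)] by (simp add: algebra_simps)
    have \<eta>0: "\<eta> u \<ge> 0"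
      unfolding \<eta>_def by (intro sum_nonneg) simp
    have "norm (?z - Q u) \<le> \<eta> u * norm ?z"
      unfolding eq using E[OF that(1)] by simp
    moreover have "norm ?z \<le> norm (Q u) + norm (?z - Q u)"
      by (metis add.commute diff_add_cancel norm_triangle_ineq)
    moreover have "\<eta> u * norm ?z \<le> 1 / 2 * norm ?z"
      using that by (intro mult_right_mono) auto
    ultimately have "norm ?z \<le> 2 * norm (Q u)"
      by linarith
    then have "\<eta> u * norm ?z \<le> \<eta> u * (2 * norm (Q u))"
      using \<eta>0 by (rule mult_left_mono)
    then show ?thesis
      using \<open>norm (?z - Q u) \<le> \<eta> u * norm ?z\<close> by simp
  qed
  obtain K where K: "\<And>u. norm (Q' u) \<le> norm u * K"
    using has_derivative_bounded_linear[OF Q'] bounded_linear.bounded by blast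
  let ?r = "\<lambda>u. norm (Q u - Q x - Q' (u - x)) / norm (u - x)"
  have r: "(?r \<longlongrightarrow> 0) (at x)"
    using Q' by (simp add: has_derivative_iff_norm)
  have "\<forall>\<^sub>F u in at x. u \<in> S"
    using S by (simp add: eventually_at_in_open')
  moreover have "\<forall>\<^sub>F u in at x. \<eta> u < 1 / 2"
    using \<eta> by (rule order_tendstoD) simp
  moreover have "\<forall>\<^sub>F u in at x. u \<noteq> x"
    by (simp add: eventually_at_filter)
  ultimately have "\<forall>\<^sub>F u in at x. norm (G u - G x - Q u) / norm (u - x) \<le> 2 * \<eta> u * (?r u + K)"
  proof eventually_elim
    case (elim u)
    have \<eta>0: "\<eta> u \<ge> 0"
      unfolding \<eta>_def by (intro sum_nonneg) simp
    have "norm (Q u) \<le> norm (Q u - Q x - Q' (u - x)) + norm (Q' (u - x))"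
      using \<open>Q x = 0\<close> by (metis diff_add_cancel diff_zero norm_triangle_ineq)
    also have "\<dots> \<le> (?r u + K) * norm (u - x)"
    proof -
      have "?r u * norm (u - x) = norm (Q u - Q x - Q' (u - x))"
        using elim by simp
      then show ?thesis
        using K[of "u - x"] by (simp only: distrib_right mult.commute[of K] add_left_mono)
    qed
    finally have "2 * \<eta> u * norm (Q u) \<le> 2 * \<eta> u * ((?r u + K) * norm (u - x))"
      using \<eta>0 by (intro mult_left_mono) auto
    then have "norm (G u - G x - Q u) \<le> 2 * \<eta> u * (?r u + K) * norm (u - x)"
      using bound[OF elim(1,2)] by simp
    then show ?case
      using elim by (simp add: pos_divide_le_eq)
  qed
  moreover have "((\<lambda>u. 2 * \<eta> u * (?r u + K)) \<longlongrightarrow> 0) (at x)"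
    using tendsto_mult[OF tendsto_mult[OF tendsto_const \<eta>] tendsto_add[OF r tendsto_const]] by simp
  ultimately have "((\<lambda>u. norm (G u - G x - Q u) / norm (u - x)) \<longlongrightarrow> 0) (at x)"
    by (rule tendsto_sandwich[OF always_eventually _ tendsto_const, rotated]) simp
  then have "((\<lambda>u. G u - Q u) has_derivative (\<lambda>_. 0)) (at x)"
    using \<open>Q x = 0\<close> by (simp add: has_derivative_iff_norm algebra_simps)
  from has_derivative_add[OF this Q'] show ?thesis
    unfolding differentiable_def by auto
qed

section \<open>Charts and retractions\<close>

locale riem_space =
  fixes M :: "('m, 'e::euclidean_space) riem"
  assumes riemannian: "riemannian_manifold M"
begin

lemma smooth: "smooth_manifold M"
  using riemannian by (simp add: riemannian_manifold_def)

lemma is_chart: "c \<in> atlas M \<Longrightarrow> is_chart (top_of M) c"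
  using smooth by (simp add: smooth_manifold_def)

lemma openin_domain: "c \<in> atlas M \<Longrightarrow> openin (top_of M) (fst c)"
  using is_chart by (simp add: is_chart_def)

lemma domain_subset: "c \<in> atlas M \<Longrightarrow> fst c \<subseteq> points M"
  by (rule openin_subset[OF openin_domain])

lemma in_points: "c \<in> atlas M \<Longrightarrow> y \<in> fst c \<Longrightarrow> y \<in> points M"
  using domain_subset by blast

lemma open_image:
  assumes "c \<in> atlas M" "openin (top_of M) U"
  shows "open (snd c ` (fst c \<inter> U))"
proof -
  have "open_map (subtopology (top_of M) (fst c)) (top_of_set (snd c ` fst c)) (snd c)"
    using is_chart[OF assms(1)] by (auto simp: is_chart_def intro: homeomorphic_imp_open_map)
  moreover have "openin (subtopology (top_of M) (fst c)) (fst c \<inter> U)"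
    using assms(2) by (metis Int_commute openin_subtopology)
  ultimately have "openin (top_of_set (snd c ` fst c)) (snd c ` (fst c \<inter> U))"
    by (auto simp: open_map_def)
  moreover have "open (snd c ` fst c)"
    using is_chart[OF assms(1)] by (simp add: is_chart_def)
  ultimately show ?thesis
    using openin_open_eq by blast
qed

lemma open_range: "c \<in> atlas M \<Longrightarrow> open (snd c ` fst c)"
  using is_chart by (simp add: is_chart_def)

lemma inj_chart: "c \<in> atlas M \<Longrightarrow> inj_on (snd c) (fst c)"
proof -
  assume c: "c \<in> atlas M"
  then have "inj_on (snd c) (topspace (subtopology (top_of M) (fst c)))"
    using is_chart[OF c] unfolding is_chart_def by (blast intro: homeomorphic_imp_injective_map)
  moreover have "topspace (subtopology (top_of M) (fst c)) = fst c"
    using domain_subset[OF c] by auto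
  ultimately show ?thesis by simp
qed

lemma chart_inv_chart: "c \<in> atlas M \<Longrightarrow> y \<in> fst c \<Longrightarrow> chart_inv c (snd c y) = y"
  by (simp add: chart_inv_def inj_chart)

lemma chart_chart_inv: "u \<in> snd c ` fst c \<Longrightarrow> snd c (chart_inv c u) = u"
  by (simp add: chart_inv_def f_inv_into_f)

lemma chart_inv_in: "u \<in> snd c ` fst c \<Longrightarrow> chart_inv c u \<in> fst c"
  by (simp add: chart_inv_def inv_into_into)

lemma chart_at: "y \<in> points M \<Longrightarrow> chart_at M y \<in> atlas M \<and> y \<in> fst (chart_at M y)"
  unfolding chart_at_def using smooth unfolding smooth_manifold_def
  by (intro someI_ex[of "\<lambda>c. c \<in> atlas M \<and> y \<in> fst c"]) blast

lemma eventually_chart_inv: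
  assumes "c \<in> atlas M" "openin (top_of M) U" "y \<in> fst c" "y \<in> U"
  shows "\<forall>\<^sub>F u in nhds (snd c y). u \<in> snd c ` fst c \<and> chart_inv c u \<in> U"
  unfolding eventually_nhds
  using assms open_image[OF assms(1,2)] chart_inv_chart[OF assms(1)]
  by (intro exI[of _ "snd c ` (fst c \<inter> U)"]) auto

lemma transition_differentiable:
  assumes "c \<in> atlas M" "d \<in> atlas M" "y \<in> fst c" "y \<in> fst d"
  shows "(snd d \<circ> chart_inv c) differentiable (at (snd c y))"
  using assms smooth unfolding smooth_manifold_def
  by (blast intro: smooth_on_imp_differentiable)

text \<open>Near \<open>snd c y\<close> the expression in \<open>c\<close> is the expression in
  \<open>d\<close> after the transition map, so the chain rule applies.\<close>

lemma change_chart: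
  assumes "c \<in> atlas M" "d \<in> atlas M" "y \<in> fst c" "y \<in> fst d"
    and \<phi>: "(\<phi> \<circ> chart_inv d) differentiable (at (snd d y))"
  shows "(\<phi> \<circ> chart_inv c) differentiable (at (snd c y))"
    and "frechet_derivative (\<phi> \<circ> chart_inv c) (at (snd c y)) v =
      frechet_derivative (\<phi> \<circ> chart_inv d) (at (snd d y))
        (frechet_derivative (snd d \<circ> chart_inv c) (at (snd c y)) v)"
proof -
  let ?\<tau> = "snd d \<circ> chart_inv c"
  have \<tau>: "?\<tau> differentiable (at (snd c y))"
    using assms by (intro transition_differentiable)
  have \<tau>y: "?\<tau> (snd c y) = snd d y"
    using assms by (simp add: chart_inv_chart)
  have ev: "\<forall>\<^sub>F u in nhds (snd c y). (\<phi> \<circ> chart_inv c) u = (\<phi> \<circ> chart_inv d) (?\<tau> u)"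
    using eventually_chart_inv[OF assms(1) openin_domain[OF assms(2)] assms(3,4)]
    by (rule eventually_mono) (simp add: chart_inv_chart[OF assms(2)])
  show "(\<phi> \<circ> chart_inv c) differentiable (at (snd c y))"
    unfolding differentiable_cong[OF ev]
    using differentiable_chain_at[OF \<tau>, of "\<phi> \<circ> chart_inv d"] \<phi> \<tau>y by (simp add: o_def)
  show "frechet_derivative (\<phi> \<circ> chart_inv c) (at (snd c y)) v =
      frechet_derivative (\<phi> \<circ> chart_inv d) (at (snd d y)) (frechet_derivative ?\<tau> (at (snd c y)) v)"
    unfolding frechet_derivative_cong[OF ev]
    using frechet_derivative_chain[OF \<tau>, of "\<phi> \<circ> chart_inv d"] \<phi> \<tau>y by simp
qed

lemma frechet_derivative_self_transition:
  assumes "c \<in> atlas M" "y \<in> fst c"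
  shows "frechet_derivative (snd c \<circ> chart_inv c) (at (snd c y)) = (\<lambda>v. v)"
proof -
  have "\<forall>\<^sub>F u in nhds (snd c y). (snd c \<circ> chart_inv c) u = u"
    using eventually_chart_inv[OF assms(1) openin_domain[OF assms(1)] assms(2,2)]
    by (rule eventually_mono) (simp add: chart_chart_inv)
  from frechet_derivative_cong[OF this] show ?thesis
    by (simp add: o_def)
qed

lemma linear_from_chart:
  assumes "c \<in> atlas M" "y \<in> fst c"
  shows "linear (from_chart M c y)"
proof -
  have "chart_at M y \<in> atlas M \<and> y \<in> fst (chart_at M y)"
    using assms by (intro chart_at in_points)
  then show ?thesis
    unfolding from_chart_def using assms
    by (intro linear_frechet_derivative transition_differentiable) auto
qed

text \<open>The two maps are differentials of mutually inverse transitions, so by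
  \<open>change_chart\<close> their composition is the differential of a transition from a chart to
  itself.\<close>

lemma to_from_chart:
  assumes "c \<in> atlas M" "y \<in> fst c"
  shows "to_chart M c y (from_chart M c y v) = v" and "from_chart M c y (to_chart M c y v) = v"
proof -
  have y: "chart_at M y \<in> atlas M" "y \<in> fst (chart_at M y)"
    using chart_at[OF in_points[OF assms]] by auto
  show "to_chart M c y (from_chart M c y v) = v"
    unfolding to_chart_def from_chart_def
    using change_chart(2)[OF assms(1) y(1) assms(2) y(2), of "snd c" v]
      transition_differentiable[OF y(1) assms(1) y(2) assms(2)]
      frechet_derivative_self_transition[OF assms] by simp
  show "from_chart M c y (to_chart M c y v) = v"
    unfolding to_chart_def from_chart_def
    using change_chart(2)[OF y(1) assms(1) y(2) assms(2), of "snd (chart_at M y)" v]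
      transition_differentiable[OF assms(1) y(1) assms(2) y(2)]
      frechet_derivative_self_transition[OF y] by simp
qed

lemma from_chart_at: "y \<in> points M \<Longrightarrow> from_chart M (chart_at M y) y v = v"
  using chart_at[of y] by (simp add: from_chart_def frechet_derivative_self_transition)

lemma to_chart_at: "y \<in> points M \<Longrightarrow> to_chart M (chart_at M y) y v = v"
  using chart_at[of y] by (simp add: to_chart_def frechet_derivative_self_transition)

lemma inner_form_metric: "y \<in> points M \<Longrightarrow> inner_form (metric M y)"
  using riemannian unfolding riemannian_manifold_def by unfold_locales auto

lemma tgrad_eq_sharp:
  "y \<in> points M \<Longrightarrow> tgrad M y h s = inner_form.sharp (metric M y) (frechet_derivative h (at s))"
  by (simp add: tgrad_def inner_form.sharp_def[OF inner_form_metric])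

lemma metric_tgrad:
  assumes "y \<in> points M" "h differentiable (at s)"
  shows "metric M y (tgrad M y h s) v = frechet_derivative h (at s) v"
  using assms tgrad_eq_sharp inner_form.sharp[OF inner_form_metric linear_frechet_derivative]
  by metis

lemma metric_thess:
  assumes "y \<in> points M" "twice_differentiable_at h s"
  shows "metric M y (thess M y h s v) w = second_derivative h s v w"
    and "linear (thess M y h s)"
proof -
  interpret inner_form "metric M y"
    using assms(1) by (rule inner_form_metric)
  have D: "(tgrad M y h has_derivative (\<lambda>v. sharp (second_derivative h s v))) (at s)"
    using has_derivative_gradient[OF assms(2)] tgrad_eq_sharp[OF assms(1), abs_def] by simp
  then have eq: "thess M y h s = (\<lambda>v. sharp (second_derivative h s v))"
    unfolding thess_def by (rule frechet_derivative_at[symmetric])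
  show "linear (thess M y h s)"
    unfolding eq using D by (rule has_derivative_linear)
  show "metric M y (thess M y h s v) w = second_derivative h s v w"
    using bilinear_second_derivative[OF assms(2)] unfolding eq
    by (simp add: bilinear_def sharp)
qed

lemma thess_self_adjoint:
  assumes "y \<in> points M" "twice_differentiable_at h s"
  shows "metric M y (thess M y h s v) w = metric M y v (thess M y h s w)"
proof -
  interpret inner_form "metric M y"
    using assms(1) by (rule inner_form_metric)
  show ?thesis
    using metric_thess(1)[OF assms] second_derivative_symmetric[OF assms(2)] commute by metis
qed

end

locale riem_retraction = riem_space M for M :: "('m, 'e::euclidean_space) riem" +
  fixes R :: "'m \<Rightarrow> 'e \<Rightarrow> 'm"
  assumes retraction: "retraction_on M R"
begin

lemma R_in_points: "x \<in> points M \<Longrightarrow> R x s \<in> points M"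
  using retraction by (simp add: retraction_on_def)

lemma R_zero: "x \<in> points M \<Longrightarrow> R x 0 = x"
  using retraction by (simp add: retraction_on_def)

lemma D_retr_zero: "x \<in> points M \<Longrightarrow> D_retr M R x 0 v = v"
  using retraction by (simp add: retraction_on_def)

text \<open>\<open>R x\<close> is the slice of the bundle-chart expression \<open>R'\<close> over
  the coordinates \<open>a\<close> of \<open>x\<close>. In the preferred chart at \<open>x\<close>
  the components of a tangent vector are the vector itself, so the slice variable is exactly
  \<open>s'\<close> and smoothness on the tangent bundle restricts.\<close>

lemma retraction_in_chart:
  assumes x: "x \<in> points M" and d: "d \<in> atlas M" and s: "R x s \<in> fst d"
  shows "\<forall>\<^sub>F s' in nhds s. R x s' \<in> fst d"
    and "twice_differentiable_at (\<lambda>s'. snd d (R x s')) s"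
proof -
  define c where "c = chart_at M x"
  define a where "a = snd c x"
  have c: "c \<in> atlas M" "x \<in> fst c"
    using chart_at[OF x] by (auto simp: c_def)
  define R' where "R' = (\<lambda>(u, w). R (chart_inv c u) (from_chart M c (chart_inv c u) w))"
  define W where "W = {(u, w). u \<in> snd c ` fst c \<and> R' (u, w) \<in> fst d}"
  have W: "open W" and smooth: "smooth_on (snd d \<circ> R') W"
    using retraction c d unfolding retraction_on_def smooth_on_TM_def Let_def R'_def W_def by auto
  have R': "R' (a, s') = R x s'" for s'
    using c x from_chart_at[OF x] by (simp add: R'_def a_def chart_inv_chart) (simp add: c_def)
  have W_iff: "(a, s') \<in> W \<longleftrightarrow> R x s' \<in> fst d" for s'
    using c(2) by (simp add: W_def R') (simp add: a_def)
  let ?H = "snd d \<circ> R'" and ?\<psi> = "\<lambda>s'. snd d (R x s')"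
  have \<psi>: "?\<psi> = (\<lambda>s'. ?H (a, s'))"
    by (simp add: R')
  have j: "((\<lambda>s'. (a, s')) has_derivative (\<lambda>v. (0, v))) (at s')" for s' :: 'e
    by (intro has_derivative_Pair has_derivative_const has_derivative_ident)
  then have jd: "(\<lambda>s'. (a, s')) differentiable (at s')" for s' :: 'e
    unfolding differentiable_def by blast
  have "open ((\<lambda>s'. (a, s')) -` W)"
    using W by (rule open_vimage) (intro continuous_intros)
  then show ev: "\<forall>\<^sub>F s' in nhds s. R x s' \<in> fst d"
    unfolding eventually_nhds using s W_iff by (intro exI[of _ "(\<lambda>s'. (a, s')) -` W"]) auto
  have H: "?H differentiable (at (a, s'))" if "R x s' \<in> fst d" for s'
    using that smooth W_iff by (blast intro: smooth_on_imp_differentiable)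
  have \<psi>': "?\<psi> differentiable (at s')"
    "frechet_derivative ?\<psi> (at s') v = frechet_derivative ?H (at (a, s')) (0, v)"
    if "R x s' \<in> fst d" for s' v
  proof -
    show "?\<psi> differentiable (at s')"
      unfolding \<psi> using differentiable_chain_at[OF jd H[OF that]] by (simp add: o_def)
    show "frechet_derivative ?\<psi> (at s') v = frechet_derivative ?H (at (a, s')) (0, v)"
      unfolding \<psi> using frechet_derivative_chain[OF jd H[OF that]]
        frechet_derivative_at[OF j[of s'], symmetric] by (simp add: o_def)
  qed
  have "(\<lambda>s'. frechet_derivative ?\<psi> (at s') v) differentiable (at s)" for v
  proof -
    have "twice_differentiable_at ?H (a, s)"
      using smooth W s W_iff by (blast intro: smooth_on_imp_twice_differentiable)
    then have "(\<lambda>z. frechet_derivative ?H (at z) (0, v)) differentiable (at (a, s))"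
      by (simp add: twice_differentiable_at_def)
    from differentiable_chain_at[OF jd this]
    have "(\<lambda>s'. frechet_derivative ?H (at (a, s')) (0, v)) differentiable (at s)"
      by (simp add: o_def)
    moreover have "\<forall>\<^sub>F s' in nhds s. frechet_derivative ?\<psi> (at s') v
        = frechet_derivative ?H (at (a, s')) (0, v)"
      using ev by (rule eventually_mono) (rule \<psi>')
    ultimately show ?thesis
      by (simp only: differentiable_cong)
  qed
  moreover have "\<forall>\<^sub>F s' in nhds s. ?\<psi> differentiable (at s')"
    using ev by (rule eventually_mono) (rule \<psi>')
  ultimately show "twice_differentiable_at ?\<psi> s"
    unfolding twice_differentiable_at_def by blast
qed

end

locale riem_objective = riem_retraction M R
  for M :: "('m, 'e::euclidean_space) riem" and R :: "'m \<Rightarrow> 'e \<Rightarrow> 'm" +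
  fixes f :: "'m \<Rightarrow> real"
  assumes C2: "C2_function M f"
begin

lemma twice_differentiable_in_chart:
  assumes "c \<in> atlas M" "y \<in> fst c"
  shows "twice_differentiable_at (f \<circ> chart_inv c) (snd c y)"
  using assms C2 open_range unfolding C2_function_def
  by (blast intro: C_on_imp_twice_differentiable)

lemma pullback_in_chart:
  assumes "x \<in> points M" "d \<in> atlas M" "R x s \<in> fst d"
  shows "\<forall>\<^sub>F s' in nhds s. pullback f R x s' = (f \<circ> chart_inv d) (snd d (R x s'))"
  using retraction_in_chart(1)[OF assms]
  by (rule eventually_mono) (simp add: pullback_def chart_inv_chart[OF assms(2)])

lemma pullback_twice_differentiable:
  assumes "x \<in> points M"
  shows "twice_differentiable_at (pullback f R x) s"
proof -
  define d where "d = chart_at M (R x s)"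
  have d: "d \<in> atlas M" "R x s \<in> fst d"
    using chart_at R_in_points[OF assms] by (auto simp: d_def)
  show ?thesis
    using twice_differentiable_compose(1)[OF retraction_in_chart(2)[OF assms d]
        twice_differentiable_in_chart[OF d]]
    by (simp only: twice_differentiable_at_cong(1)[OF pullback_in_chart[OF assms d]])
qed

lemma pullback_differentiable:
  "x \<in> points M \<Longrightarrow> pullback f R x differentiable (at s)"
  by (intro twice_differentiable_imp_differentiable pullback_twice_differentiable)

lemma frechet_derivative_pullback:
  assumes "x \<in> points M"
  shows "frechet_derivative (pullback f R x) (at s) v = differential M f (R x s) (D_retr M R x s v)"
proof -
  define d where "d = chart_at M (R x s)"
  have d: "d \<in> atlas M" "R x s \<in> fst d"
    using chart_at R_in_points[OF assms] by (auto simp: d_def)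
  show ?thesis
    unfolding frechet_derivative_cong[OF pullback_in_chart[OF assms d]] differential_def D_retr_def
      d_def[symmetric]
    by (rule frechet_derivative_chain[OF retraction_in_chart(2)[OF assms d, THEN
            twice_differentiable_imp_differentiable]
          twice_differentiable_in_chart[OF d, THEN twice_differentiable_imp_differentiable]])
qed

lemma linear_differential:
  assumes "y \<in> points M"
  shows "linear (differential M f y)"
  unfolding differential_def
  using chart_at[OF assms]
  by (intro linear_frechet_derivative twice_differentiable_imp_differentiable
      twice_differentiable_in_chart) auto

lemma metric_rgrad:
  assumes "y \<in> points M"
  shows "metric M y (rgrad M f y) v = differential M f y v"
  using inner_form.sharp[OF inner_form_metric[OF assms] linear_differential[OF assms]]
  by (simp add: rgrad_def inner_form.sharp_def[OF inner_form_metric[OF assms]])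

lemma linear_D_retr:
  assumes "x \<in> points M"
  shows "linear (D_retr M R x s)"
  unfolding D_retr_def
  using chart_at[OF R_in_points[OF assms]] retraction_in_chart(2)[OF assms]
  by (intro linear_frechet_derivative twice_differentiable_imp_differentiable) auto

lemma tgrad_pullback_zero:
  assumes "x \<in> points M"
  shows "tgrad M x (pullback f R x) 0 = rgrad M f x"
proof -
  interpret inner_form "metric M x"
    using assms by (rule inner_form_metric)
  show ?thesis
    by (rule eqI) (simp add: assms metric_tgrad pullback_differentiable frechet_derivative_pullback
        R_zero D_retr_zero metric_rgrad)
qed

text \<open>The gradient of the pullback is the adjoint of \<open>D = D_retr M R x s\<close> applied to the Riemannian
  gradient, and \<open>b \<le> sigma_min D\<close> makes \<open>D\<close> invertible with \<open>b * nrm u \<le> nrm (D u)\<close>.\<close>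

lemma sigma_min_gradient_bound:
  assumes x: "x \<in> points M" and "b > 0" and \<sigma>: "sigma_min M x (R x s) (D_retr M R x s) \<ge> b"
  shows "b * tnorm M (R x s) (rgrad M f (R x s)) \<le> tnorm M x (tgrad M x (pullback f R x) s)"
proof -
  define y where "y = R x s"
  define D where "D = D_retr M R x s"
  define h where "h = pullback f R x"
  have y: "y \<in> points M"
    using R_in_points[OF x] by (simp add: y_def)
  interpret x: inner_form "metric M x" using x by (rule inner_form_metric)
  interpret y: inner_form "metric M y" using y by (rule inner_form_metric)
  have D: "linear D"
    unfolding D_def using x by (rule linear_D_retr)
  let ?A = "tadjoint M x y D"
  have adj: "metric M x (?A w) u = metric M y w (D u)" for w u
  proof -
    have "linear (\<lambda>u. metric M y w (D u))"
      using linear_compose[OF D, of "metric M y w"] y.bilinear by (simp add: bilinear_def o_def)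
    from x.sharp[OF this] show ?thesis
      by (simp add: tadjoint_def x.sharp_def)
  qed
  have "linear (?A \<circ> D)"
    by (rule linearI; rule x.eqI)
       (simp_all add: adj x.add_left x.scaleR_left y.add_left y.scaleR_left
         linear_add[OF D] linear_scale[OF D])
  moreover have "metric M x ((?A \<circ> D) v) w = metric M x v ((?A \<circ> D) w)" for v w
    using adj[of "D v" w] adj[of "D w" v] x.commute y.commute by (metis comp_apply)
  ultimately have "lambda_min (?A \<circ> D) * metric M x u u \<le> metric M x ((?A \<circ> D) u) u" for u
    by (rule x.lambda_min_le)
  moreover have lm: "b\<^sup>2 \<le> lambda_min (?A \<circ> D)"
  proof -
    have "b \<le> sqrt (lambda_min (?A \<circ> D))"
      using \<sigma> by (simp add: sigma_min_def y_def D_def)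
    \<comment> \<open>\<open>sqrt\<close> is an odd function on the reals, so the eigenvalue must be
      known to be positive before the bound is squared.\<close>
    moreover from this have "lambda_min (?A \<circ> D) > 0"
      using \<open>b > 0\<close> less_le_trans real_sqrt_gt_0_iff by blast
    ultimately show ?thesis
      using power_mono[of b "sqrt (lambda_min (?A \<circ> D))" 2] \<open>b > 0\<close> by simp
  qed
  ultimately have "b\<^sup>2 * metric M x u u \<le> metric M y (D u) (D u)" for u
    using mult_right_mono[OF lm x.nonneg] by (fastforce simp: adj intro: order_trans)
  then have lower: "b * x.nrm u \<le> y.nrm (D u)" for u
    using \<open>b > 0\<close> real_sqrt_le_mono[of "b\<^sup>2 * metric M x u u"]
    by (simp add: x.nrm_def y.nrm_def real_sqrt_mult)
  have "inj D"
  proof (rule inj_onI)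
    fix u v assume "D u = D v"
    then have "D (u - v) = 0"
      by (simp add: linear_diff[OF D])
    then have "b * x.nrm (u - v) \<le> 0"
      using lower[of "u - v"] by simp
    then have "x.nrm (u - v) = 0"
      using \<open>b > 0\<close> x.nrm_nonneg[of "u - v"] by (simp add: mult_le_0_iff)
    then show "u = v" by simp
  qed
  then obtain u where u: "D u = rgrad M f y"
    using linear_injective_imp_surjective[OF D] by (metis surjD)
  let ?g = "tgrad M x h s"
  \<comment> \<open>The preimage \<open>u\<close> turns the squared norm of the Riemannian gradient
    into the derivative of the pullback along \<open>u\<close>.\<close>
  have "(y.nrm (D u))\<^sup>2 = metric M y (rgrad M f y) (D u)"
    by (simp add: u y.nrm_square)
  also have "\<dots> = metric M x ?g u"
    using x y by (simp add: metric_rgrad metric_tgrad pullback_differentiable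
        frechet_derivative_pullback h_def y_def D_def)
  also have "\<dots> \<le> x.nrm ?g * x.nrm u"
    by (rule x.cauchy_schwarz)
  finally have "b * (y.nrm (D u))\<^sup>2 \<le> b * (x.nrm ?g * x.nrm u)"
    using \<open>b > 0\<close> by simp
  also have "\<dots> = x.nrm ?g * (b * x.nrm u)"
    by simp
  also have "\<dots> \<le> x.nrm ?g * y.nrm (D u)"
    using lower by (intro mult_left_mono) auto
  finally have "b * y.nrm (D u) * y.nrm (D u) \<le> x.nrm ?g * y.nrm (D u)"
    by (simp add: power2_eq_square mult.assoc)
  then have "b * y.nrm (D u) \<le> x.nrm ?g"
    using y.nrm_nonneg[of "D u"] x.nrm_nonneg[of ?g] by (cases "y.nrm (D u) = 0") auto
  then show ?thesis
    by (simp add: u x.nrm_def y.nrm_def tnorm_def y_def[symmetric] h_def[symmetric])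
qed

end

section \<open>The Riemannian Hessian and second-order retractions\<close>

lemma has_vector_derivative_along_line:
  assumes "(h has_derivative D) (at (t *\<^sub>R v))"
  shows "((\<lambda>\<tau>. h (\<tau> *\<^sub>R v)) has_vector_derivative D v) (at t)"
proof -
  have "((\<lambda>\<tau>. \<tau> *\<^sub>R v) has_derivative (\<lambda>r. r *\<^sub>R v)) (at t)"
    by (auto intro!: derivative_eq_intros)
  from has_derivative_compose[OF this assms]
  show ?thesis
    using linear_scale[OF has_derivative_linear[OF assms]] by (simp add: has_vector_derivative_def)
qed

context riem_space
begin

section \<open>The metric in a chart, its derivatives and the Christoffel symbols\<close>

lemma inner_form_chart_metric:
  assumes "c \<in> atlas M" "u \<in> snd c ` fst c"
  shows "inner_form (chart_metric M c u)"
proof -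
  define y where "y = chart_inv c u"
  have y: "y \<in> fst c" "y \<in> points M"
    using chart_inv_in[OF assms(2)] in_points[OF assms(1)] by (auto simp: y_def)
  interpret inner_form "metric M y" using y(2) by (rule inner_form_metric)
  have eq: "chart_metric M c u = (\<lambda>v w. metric M y (from_chart M c y v) (from_chart M c y w))"
    by (simp add: chart_metric_def y_def Let_def fun_eq_iff)
  have lin: "linear (from_chart M c y)"
    by (rule linear_from_chart[OF assms(1) y(1)])
  show ?thesis
    unfolding eq
  proof
    show "bilinear (\<lambda>v w. metric M y (from_chart M c y v) (from_chart M c y w))"
      unfolding bilinear_def
      by (intro conjI allI linearI)
         (simp_all add: linear_add[OF lin] linear_scale[OF lin] add_left add_right scaleR_left scaleR_right)
    show "metric M y (from_chart M c y v) (from_chart M c y w) =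
        metric M y (from_chart M c y w) (from_chart M c y v)" for v w
      by (rule commute)
    show "0 < metric M y (from_chart M c y v) (from_chart M c y v)" if "v \<noteq> 0" for v
      using that to_from_chart(1)[OF assms(1) y(1), of v] to_from_chart(1)[OF assms(1) y(1), of 0]
        linear_0[OF lin] by (intro positive) metis
  qed
qed

lemma chart_metric_at:
  assumes "x \<in> points M"
  shows "chart_metric M (chart_at M x) (snd (chart_at M x) x) = metric M x"
  using chart_at[OF assms] assms
  by (simp add: chart_metric_def chart_inv_chart from_chart_at Let_def fun_eq_iff)

lemma chart_metric_differentiable:
  assumes "c \<in> atlas M" "u \<in> snd c ` fst c"
  shows "(\<lambda>u. chart_metric M c u v w) differentiable (at u)"
  using assms riemannian unfolding riemannian_manifold_def
  by (blast intro: smooth_on_imp_differentiable)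

definition metric_deriv :: "('m, 'e) chart \<Rightarrow> 'e \<Rightarrow> 'e \<Rightarrow> 'e \<Rightarrow> 'e \<Rightarrow> real" where
  "metric_deriv c u z v w = frechet_derivative (\<lambda>u. chart_metric M c u v w) (at u) z"

lemma has_derivative_chart_metric:
  assumes "c \<in> atlas M" "u \<in> snd c ` fst c"
  shows "((\<lambda>u. chart_metric M c u v w) has_derivative (\<lambda>z. metric_deriv c u z v w)) (at u)"
  using chart_metric_differentiable[OF assms] unfolding metric_deriv_def
  by (simp add: frechet_derivative_works[symmetric])

text \<open>An identity between metric components that holds on the whole open coordinate domain
  passes to derivatives; symmetry and bilinearity of \<open>metric_deriv c u z\<close> come from
  here.\<close>

lemma metric_deriv_eqI:
  assumes c: "c \<in> atlas M" and u: "u \<in> snd c ` fst c"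
    and eq: "\<And>u. u \<in> snd c ` fst c \<Longrightarrow> chart_metric M c u v w = h u"
    and h: "(h has_derivative h') (at u)"
  shows "metric_deriv c u z v w = h' z"
proof -
  have "\<forall>\<^sub>F u in nhds u. chart_metric M c u v w = h u"
    unfolding eventually_nhds using eq u open_range[OF c] by blast
  from frechet_derivative_cong[OF this] show ?thesis
    unfolding metric_deriv_def using frechet_derivative_at[OF h] by simp
qed

lemma
  assumes c: "c \<in> atlas M" and u: "u \<in> snd c ` fst c"
  shows metric_deriv_commute: "metric_deriv c u z v w = metric_deriv c u z w v"
    and linear_metric_deriv: "linear (\<lambda>z. metric_deriv c u z v w)"
    and linear_metric_deriv_left: "linear (\<lambda>v. metric_deriv c u z v w)"
    and linear_metric_deriv_right: "linear (\<lambda>w. metric_deriv c u z v w)"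
proof -
  note d = has_derivative_chart_metric[OF c u]
  note inner = inner_form_chart_metric[OF c]
  have bb: "bounded_bilinear (chart_metric M c u)" if "u \<in> snd c ` fst c" for u
    using inner[OF that] by (rule inner_form.bounded_bilinear)
  show comm: "metric_deriv c u z v w = metric_deriv c u z w v" for v w
    using inner_form.commute[OF inner] by (intro metric_deriv_eqI[OF c u _ d])
  show "linear (\<lambda>z. metric_deriv c u z v w)"
    using d by (rule has_derivative_linear)
  show lin: "linear (\<lambda>v. metric_deriv c u z v w)" for w
  proof (rule linearI)
    show "metric_deriv c u z (v1 + v2) w = metric_deriv c u z v1 w + metric_deriv c u z v2 w" for v1 v2
      using bounded_bilinear.add_left[OF bb]
      by (intro metric_deriv_eqI[OF c u _ has_derivative_add[OF d d]])
    show "metric_deriv c u z (r *\<^sub>R v) w = r *\<^sub>R metric_deriv c u z v w" for r v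
      using bounded_bilinear.scaleR_left[OF bb]
      by (intro metric_deriv_eqI[OF c u _ has_derivative_scaleR_right[OF d]])
  qed
  show "linear (\<lambda>w. metric_deriv c u z v w)"
    using lin[of v] by (simp add: comm[of v])
qed

text \<open>Koszul's expression is linear in \<open>z\<close>, which makes the definite description
  in \<open>christoffel\<close> meaningful.\<close>

lemma chart_metric_christoffel:
  assumes c: "c \<in> atlas M" and u: "u \<in> snd c ` fst c"
  shows "chart_metric M c u (christoffel M c u v w) z =
    (metric_deriv c u v w z + metric_deriv c u w v z - metric_deriv c u z v w) / 2"
proof -
  interpret inner_form "chart_metric M c u"
    using c u by (rule inner_form_chart_metric)
  let ?K = "\<lambda>z. (metric_deriv c u v w z + metric_deriv c u w v z - metric_deriv c u z v w) / 2"
  note lin = linear_metric_deriv[OF c u] linear_metric_deriv_right[OF c u]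
  have "linear ?K"
    by (intro linearI) (simp_all add: linear_add[OF lin(1)] linear_add[OF lin(2)]
        linear_scale[OF lin(1)] linear_scale[OF lin(2)] field_simps)
  from sharp[OF this] show ?thesis
    by (simp add: christoffel_def sharp_def metric_deriv_def)
qed

end

context riem_objective
begin

text \<open>The preferred chart of a nearby point is an arbitrary choice, so the components
  \<open>rgrad M f\<close> need not even vary continuously. Moved to the fixed chart
  \<open>c\<close>, the gradient solves an equation whose data are regular in
  \<open>u\<close>.\<close>

lemma gradient_in_chart:
  assumes c: "c \<in> atlas M" and u: "u \<in> snd c ` fst c"
  shows "chart_metric M c u (to_chart M c (chart_inv c u) (rgrad M f (chart_inv c u))) w =
    frechet_derivative (f \<circ> chart_inv c) (at u) w"
proof -
  define y where "y = chart_inv c u"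
  have y: "y \<in> fst c" "y \<in> points M"
    using chart_inv_in[OF u] in_points[OF c] by (auto simp: y_def)
  have uy: "u = snd c y"
    using chart_chart_inv[OF u] by (simp add: y_def)
  have d: "chart_at M y \<in> atlas M" "y \<in> fst (chart_at M y)"
    using chart_at[OF y(2)] by auto
  have "chart_metric M c u (to_chart M c y (rgrad M f y)) w =
      metric M y (rgrad M f y) (from_chart M c y w)"
    by (simp add: chart_metric_def y_def[symmetric] Let_def to_from_chart[OF c y(1)])
  also have "\<dots> = frechet_derivative (f \<circ> chart_inv (chart_at M y)) (at (snd (chart_at M y) y))
      (from_chart M c y w)"
    using metric_rgrad[OF y(2)] by (simp add: differential_def)
  also have "\<dots> = frechet_derivative (f \<circ> chart_inv c) (at u) w"
    unfolding uy from_chart_def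
    using change_chart(2)[OF c d(1) y(1) d(2)] twice_differentiable_in_chart[OF d]
      twice_differentiable_imp_differentiable by metis
  finally show ?thesis
    by (simp add: y_def)
qed

text \<open>The coordinate formula D^2 F(v, w) - <\<Gamma>(v, w), grad f>, with Koszul's expression
  in place of the Christoffel symbol. Differentiating \<open>gG\<close> along \<open>v\<close> also
  differentiates the metric; half of that contribution is cancelled by the Christoffel term of the
  covariant derivative.\<close>

lemma metric_rhess:
  assumes x: "x \<in> points M"
  defines "c \<equiv> chart_at M x"
  defines "u \<equiv> snd c x"
  shows "metric M x (rhess M f x v) w =
      second_derivative (f \<circ> chart_inv c) u v w -
      (metric_deriv c u v w (rgrad M f x) + metric_deriv c u w v (rgrad M f x)
        - metric_deriv c u (rgrad M f x) v w) / 2"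
proof -
  have c: "c \<in> atlas M" "x \<in> fst c"
    using chart_at[OF x] by (auto simp: c_def)
  let ?S = "snd c ` fst c"
  have u: "u \<in> ?S"
    using c by (auto simp: u_def)
  define g where "g = chart_metric M c"
  define F where "F = f \<circ> chart_inv c"
  define G where "G u = to_chart M c (chart_inv c u) (rgrad M f (chart_inv c u))" for u
  have F: "twice_differentiable_at F u"
    unfolding F_def u_def using c by (rule twice_differentiable_in_chart)
  have Gu: "G u = rgrad M f x"
    using c x to_chart_at[OF x] by (simp add: G_def u_def chart_inv_chart) (simp add: c_def)
  have gx: "g u = metric M x"
    using chart_metric_at[OF x] by (simp add: g_def u_def c_def)
  have gG: "g u (G u) w = frechet_derivative F (at u) w" if "u \<in> ?S" for u w
    using gradient_in_chart[OF c(1) that] by (simp add: g_def G_def F_def)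
  have g_inner: "inner_form (g u)" if "u \<in> ?S" for u
    unfolding g_def using c(1) that by (rule inner_form_chart_metric)
  \<comment> \<open>The product rule below presupposes a derivative of \<open>G\<close>, which is
    known only through its pairings \<open>gG\<close>.\<close>
  have "G differentiable (at u)"
  proof (rule differentiable_representative[OF open_range[OF c(1)] u g_inner gG])
    show "(\<lambda>u. g u v w) differentiable (at u)" for v w
      unfolding g_def by (rule chart_metric_differentiable[OF c(1) u])
    show "(\<lambda>u. frechet_derivative F (at u) w) differentiable (at u)" for w
      using F by (simp add: twice_differentiable_at_def)
  qed
  then have G': "(G has_derivative frechet_derivative G (at u)) (at u)"
    by (simp add: frechet_derivative_works[symmetric])
  interpret inner_form "g u" using u by (rule g_inner)
  have lin_g: "linear (\<lambda>v. g u v w)" if "u \<in> ?S" for u w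
    using inner_form.bilinear[OF g_inner[OF that]] by (simp add: bilinear_def)
  have product: "g u (frechet_derivative G (at u) v) w + metric_deriv c u v (G u) w
      = second_derivative F u v w"
  proof -
    let ?h' = "\<lambda>v. \<Sum>b\<in>Basis. (G u \<bullet> b) * metric_deriv c u v b w +
        (frechet_derivative G (at u) v \<bullet> b) * g u b w"
    have "((\<lambda>u. \<Sum>b\<in>Basis. (G u \<bullet> b) * g u b w) has_derivative ?h') (at u)"
      unfolding g_def
      by (intro has_derivative_sum has_derivative_mult has_derivative_inner_left G'
          has_derivative_chart_metric[OF c(1) u])
    moreover have "\<forall>\<^sub>F u in nhds u. frechet_derivative F (at u) w = (\<Sum>b\<in>Basis. (G u \<bullet> b) * g u b w)"
      unfolding eventually_nhds
    proof (intro exI[of _ ?S] conjI ballI)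
      show "frechet_derivative F (at y) w = (\<Sum>b\<in>Basis. (G y \<bullet> b) * g y b w)" if "y \<in> ?S" for y
        using linear_expand[OF lin_g[OF that, of w], of "G y"] gG[OF that] by simp
    qed (use open_range[OF c(1)] u in auto)
    ultimately have "((\<lambda>u. frechet_derivative F (at u) w) has_derivative ?h') (at u)"
      by (simp add: has_derivative_cong_nhds)
    from fun_cong[OF frechet_derivative_at[OF this], of v]
    have "second_derivative F u v w = ?h' v"
      unfolding second_derivative_def by (rule sym)
    also have "\<dots> = metric_deriv c u v (G u) w + g u (frechet_derivative G (at u) v) w"
      by (simp add: sum.distrib linear_expand[OF lin_g[OF u, of w], of "frechet_derivative G (at u) v"]
          linear_expand[OF linear_metric_deriv_left[OF c(1) u, of v w], of "G u"])
    finally show ?thesis by simp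
  qed
  have "rhess M f x v = frechet_derivative G (at u) v + christoffel M c u v (rgrad M f x)"
    by (simp add: rhess_def cov_deriv_def Let_def c_def[symmetric] u_def[symmetric] G_def[abs_def])
  then have "metric M x (rhess M f x v) w = g u (frechet_derivative G (at u) v) w +
      g u (christoffel M c u v (rgrad M f x)) w"
    by (simp add: gx[symmetric] add_left)
  also have "\<dots> = second_derivative F u v w - metric_deriv c u v (rgrad M f x) w +
      (metric_deriv c u v (rgrad M f x) w + metric_deriv c u (rgrad M f x) v w
        - metric_deriv c u w v (rgrad M f x)) / 2"
    using product chart_metric_christoffel[OF c(1) u, of v "rgrad M f x" w]
    unfolding g_def Gu by linarith
  finally show ?thesis
    using metric_deriv_commute[OF c(1) u, of v "rgrad M f x" w]
    by (simp add: F_def field_simps)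
qed

lemma linear_rhess:
  assumes x: "x \<in> points M"
  shows "linear (rhess M f x)"
proof -
  interpret inner_form "metric M x" using x by (rule inner_form_metric)
  define c where "c = chart_at M x"
  have c: "c \<in> atlas M" "x \<in> fst c"
    using chart_at[OF x] by (auto simp: c_def)
  then have u: "snd c x \<in> snd c ` fst c" by blast
  note lin = linear_metric_deriv[OF c(1) u] linear_metric_deriv_left[OF c(1) u]
    linear_second_derivative[OF twice_differentiable_in_chart[OF c]]
  show ?thesis
    by (rule linearI; rule eqI)
       (simp_all add: metric_rhess[OF x, folded c_def] add_left scaleR_left
         linear_add[OF lin(1)] linear_add[OF lin(2)] linear_add[OF lin(3)]
         linear_scale[OF lin(1)] linear_scale[OF lin(2)] linear_scale[OF lin(3)] field_simps)
qed

text \<open>Second derivatives commute and the connection has no torsion: exchanging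
  \<open>v\<close> and \<open>w\<close> in \<open>metric_rhess\<close> only permutes the metric
  terms.\<close>

lemma rhess_self_adjoint:
  assumes x: "x \<in> points M"
  shows "metric M x (rhess M f x v) w = metric M x v (rhess M f x w)"
proof -
  interpret inner_form "metric M x" using x by (rule inner_form_metric)
  define c where "c = chart_at M x"
  have c: "c \<in> atlas M" "x \<in> fst c"
    using chart_at[OF x] by (auto simp: c_def)
  then have u: "snd c x \<in> snd c ` fst c" by blast
  have "metric M x (rhess M f x v) w = metric M x (rhess M f x w) v"
    unfolding metric_rhess[OF x, folded c_def]
    using second_derivative_symmetric[OF twice_differentiable_in_chart[OF c], of v w]
      metric_deriv_commute[OF c(1) u, of "rgrad M f x" v w] by simp
  then show ?thesis
    by (simp add: commute)
qed

section \<open>Curves along a retraction and the Hessian of the pullback\<close>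

lemma velocity_along_retraction:
  assumes x: "x \<in> points M"
  shows "velocity M (\<lambda>t. R x (t *\<^sub>R v)) \<tau> = D_retr M R x (\<tau> *\<^sub>R v) v"
proof -
  define d where "d = chart_at M (R x (\<tau> *\<^sub>R v))"
  have d: "d \<in> atlas M" "R x (\<tau> *\<^sub>R v) \<in> fst d"
    using chart_at R_in_points[OF x] by (auto simp: d_def)
  have "((\<lambda>s. snd d (R x s)) has_derivative D_retr M R x (\<tau> *\<^sub>R v)) (at (\<tau> *\<^sub>R v))"
    unfolding D_retr_def d_def[symmetric]
    using retraction_in_chart(2)[OF x d, THEN twice_differentiable_imp_differentiable]
    by (simp add: frechet_derivative_works[symmetric])
  from has_vector_derivative_along_line[OF this] show ?thesis
    unfolding velocity_def d_def[symmetric] by (rule vector_derivative_at)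
qed

text \<open>\<open>D_retr\<close> is expressed in the preferred chart of the moving point
  \<open>R x s\<close>. In a fixed chart the same vector is the derivative of a fixed map and can be
  differentiated once more in \<open>s\<close>.\<close>

lemma to_chart_D_retr:
  assumes x: "x \<in> points M" and c: "c \<in> atlas M" "R x s \<in> fst c"
  shows "to_chart M c (R x s) (D_retr M R x s v) = frechet_derivative (\<lambda>s. snd c (R x s)) (at s) v"
proof -
  define d where "d = chart_at M (R x s)"
  have d: "d \<in> atlas M" "R x s \<in> fst d"
    using chart_at R_in_points[OF x] by (auto simp: d_def)
  have ev: "\<forall>\<^sub>F s' in nhds s. snd c (R x s') = (snd c \<circ> chart_inv d) (snd d (R x s'))"
    using retraction_in_chart(1)[OF x d]
    by (rule eventually_mono) (simp add: chart_inv_chart[OF d(1)])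
  show ?thesis
    unfolding frechet_derivative_cong[OF ev] to_chart_def D_retr_def d_def[symmetric]
    by (rule frechet_derivative_chain[OF retraction_in_chart(2)[OF x d, THEN
            twice_differentiable_imp_differentiable] transition_differentiable[OF d(1) c(1) d(2) c(2)],
          symmetric])
qed

text \<open>In the preferred chart at \<open>x\<close> the vanishing acceleration reads
  \<open>D\<^sup>2\<psi>(v, v) = - \<Gamma>(v, v)\<close> with \<open>\<psi> = snd c \<circ> R x\<close>.\<close>

lemma second_order_retraction_in_chart:
  assumes x: "x \<in> points M" and R2: "second_order_retraction M R"
  defines "c \<equiv> chart_at M x"
  shows "second_derivative (\<lambda>s. snd c (R x s)) 0 v v = - christoffel M c (snd c x) v v"
proof -
  have c: "c \<in> atlas M" "R x 0 \<in> fst c"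
    using chart_at[OF x] by (auto simp: c_def R_zero[OF x])
  let ?\<psi> = "\<lambda>s. snd c (R x s)"
  have "((\<lambda>s. frechet_derivative ?\<psi> (at s) v) has_derivative (\<lambda>z. second_derivative ?\<psi> 0 z v))
      (at (0 *\<^sub>R v))"
    using has_second_derivative[OF retraction_in_chart(2)[OF x c]] by simp
  from has_vector_derivative_along_line[OF this]
  have line: "((\<lambda>\<tau>. frechet_derivative ?\<psi> (at (\<tau> *\<^sub>R v)) v) has_vector_derivative
      second_derivative ?\<psi> 0 v v) (at 0)" .
  have "filterlim (\<lambda>\<tau>::real. \<tau> *\<^sub>R v) (nhds (0 *\<^sub>R v)) (nhds 0)"
    by (intro tendsto_intros filterlim_ident)
  then have "\<forall>\<^sub>F \<tau> in nhds (0::real). R x (\<tau> *\<^sub>R v) \<in> fst c"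
    using retraction_in_chart(1)[OF x c] unfolding filterlim_iff scaleR_zero_left by blast
  then have "\<forall>\<^sub>F \<tau> in nhds 0. to_chart M c (R x (\<tau> *\<^sub>R v)) (velocity M (\<lambda>t. R x (t *\<^sub>R v)) \<tau>)
      = frechet_derivative ?\<psi> (at (\<tau> *\<^sub>R v)) v"
    by (rule eventually_mono)
       (simp add: velocity_along_retraction[OF x] to_chart_D_retr[OF x c(1)])
  then have "((\<lambda>\<tau>. to_chart M c (R x (\<tau> *\<^sub>R v)) (velocity M (\<lambda>t. R x (t *\<^sub>R v)) \<tau>))
      has_vector_derivative second_derivative ?\<psi> 0 v v) (at 0)"
    using line unfolding has_vector_derivative_def by (simp add: has_derivative_cong_nhds)
  from vector_derivative_at[OF this]
  have "acceleration M (\<lambda>t. R x (t *\<^sub>R v)) 0 =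
      second_derivative ?\<psi> 0 v v + christoffel M c (snd c x) v v"
    by (simp add: acceleration_def cov_deriv_along_def R_zero[OF x] Let_def c_def[symmetric]
        velocity_along_retraction[OF x] D_retr_zero[OF x])
  moreover have "acceleration M (\<lambda>t. R x (t *\<^sub>R v)) 0 = 0"
    using R2 x by (simp add: second_order_retraction_def)
  ultimately show ?thesis
    by (simp add: eq_neg_iff_add_eq_0)
qed

text \<open>The chain rule gives D^2 F(v, v) + DF(D^2 \<psi>(v, v)). Zero acceleration replaces D^2
  \<psi>(v, v) by - \<Gamma>(v, v), and what results is the coordinate formula of
  \<open>metric_rhess\<close>. Acceleration sees only the diagonal, and the diagonal determines
  bounds on eigenvalues.\<close>

lemma rhess_eq_thess_pullback:
  assumes x: "x \<in> points M" and R2: "second_order_retraction M R"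
  shows "metric M x (rhess M f x v) v = metric M x (thess M x (pullback f R x) 0 v) v"
proof -
  define c where "c = chart_at M x"
  have c: "c \<in> atlas M" "R x 0 \<in> fst c" "x \<in> fst c"
    using chart_at[OF x] by (auto simp: c_def R_zero[OF x])
  then have u: "snd c x \<in> snd c ` fst c" by blast
  let ?\<psi> = "\<lambda>s. snd c (R x s)" and ?F = "f \<circ> chart_inv c"
  have \<psi>: "twice_differentiable_at ?\<psi> 0"
    by (rule retraction_in_chart(2)[OF x c(1,2)])
  have F: "twice_differentiable_at ?F (snd c (R x 0))"
    by (rule twice_differentiable_in_chart[OF c(1,2)])
  have \<psi>': "frechet_derivative ?\<psi> (at 0) v = v"
    using D_retr_zero[OF x, of v] by (simp add: D_retr_def R_zero[OF x] c_def)
  have "metric M x (thess M x (pullback f R x) 0 v) v = second_derivative (pullback f R x) 0 v v"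
    by (rule metric_thess(1)[OF x pullback_twice_differentiable[OF x]])
  also have "\<dots> = second_derivative (\<lambda>s. ?F (?\<psi> s)) 0 v v"
    unfolding twice_differentiable_at_cong(2)[OF pullback_in_chart[OF x c(1,2)]] ..
  also have "\<dots> = second_derivative ?F (snd c x) v v +
      frechet_derivative ?F (at (snd c x)) (- christoffel M c (snd c x) v v)"
    using twice_differentiable_compose(2)[OF \<psi> F, of v v]
      second_order_retraction_in_chart[OF x R2, of v, folded c_def]
    by (simp add: \<psi>' R_zero[OF x] o_def)
  also have "frechet_derivative ?F (at (snd c x)) (- christoffel M c (snd c x) v v) =
      - metric M x (rgrad M f x) (christoffel M c (snd c x) v v)"
    using metric_rgrad[OF x, of "- christoffel M c (snd c x) v v"]
      bounded_bilinear.minus_right[OF inner_form.bounded_bilinear[OF inner_form_metric[OF x]]]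
    by (simp add: differential_def c_def)
  also have "metric M x (rgrad M f x) (christoffel M c (snd c x) v v) =
      (metric_deriv c (snd c x) v v (rgrad M f x) + metric_deriv c (snd c x) v v (rgrad M f x)
        - metric_deriv c (snd c x) (rgrad M f x) v v) / 2"
    using chart_metric_christoffel[OF c(1) u, of v v "rgrad M f x"] chart_metric_at[OF x]
      inner_form.commute[OF inner_form_metric[OF x]] by (simp add: c_def)
  finally show ?thesis
    using metric_rhess[OF x, of v v] by (simp add: c_def o_def)
qed

lemma lambda_min_rhess_ge:
  assumes x: "x \<in> points M" and R2: "second_order_retraction M R"
    and lower: "\<And>v. l * metric M x v v \<le> metric M x (thess M x (pullback f R x) 0 v) v"
  shows "l \<le> lambda_min (rhess M f x)"
proof -
  interpret inner_form "metric M x" using x by (rule inner_form_metric)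
  show ?thesis
    using lambda_min_ge[where T = "rhess M f x", OF linear_rhess[OF x] rhess_self_adjoint[OF x]]
      lower rhess_eq_thess_pullback[OF x R2] by simp
qed

end

section \<open>The cubic model\<close>

text \<open>Covers \<open>b = 0\<close>, where the quotient is 0 by convention; with
  \<open>b\<close> the length of the trial step this is the case of termination.\<close>

lemma divide_le_if_le_mult:
  fixes a b c :: real
  assumes "a \<le> b * c" "0 \<le> b" "0 \<le> c"
  shows "a / b \<le> c"
  using assms by (cases "b = 0") (simp_all add: divide_le_eq mult.commute)

context riem_objective
begin

lemma tnorm_eq_nrm: "y \<in> points M \<Longrightarrow> tnorm M y v = inner_form.nrm (metric M y) v"
  by (simp add: tnorm_def inner_form.nrm_def[OF inner_form_metric])

lemma tnorm_nonneg: "y \<in> points M \<Longrightarrow> tnorm M y v \<ge> 0"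
  by (simp add: tnorm_eq_nrm inner_form.nrm_nonneg[OF inner_form_metric])

lemma tnorm_eq_0_iff: "y \<in> points M \<Longrightarrow> tnorm M y v = 0 \<longleftrightarrow> v = 0"
  by (simp add: tnorm_eq_nrm inner_form.nrm_eq_0_iff[OF inner_form_metric])

text \<open>Self-adjointness of the Hessian merges the two halves of the derivative of the quadratic
  term. The cubic term contributes \<open>\<sigma> *\<^sub>R (tnorm M x s *\<^sub>R s)\<close>,
  which is differentiable also at \<open>s = 0\<close>, the step at which a run stops.\<close>

lemma
  assumes x: "x \<in> points M"
  shows tgrad_arc_model: "tgrad M x (arc_model M R f x \<sigma>) s =
      tgrad M x (pullback f R x) 0 + thess M x (pullback f R x) 0 s + \<sigma> *\<^sub>R (tnorm M x s *\<^sub>R s)"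
    and arc_model_twice_differentiable: "twice_differentiable_at (arc_model M R f x \<sigma>) s"
    and thess_arc_model: "thess M x (arc_model M R f x \<sigma>) s v = thess M x (pullback f R x) 0 v +
      \<sigma> *\<^sub>R (tnorm M x s *\<^sub>R v + (metric M x s v / tnorm M x s) *\<^sub>R s)"
proof -
  interpret inner_form "metric M x" using x by (rule inner_form_metric)
  define h where "h = pullback f R x"
  define d where "d = tgrad M x h 0"
  define H where "H = thess M x h 0"
  let ?m = "arc_model M R f x \<sigma>"
  let ?G = "\<lambda>s. d + H s + \<sigma> *\<^sub>R (nrm s *\<^sub>R s)"
  have h: "twice_differentiable_at h 0"
    unfolding h_def using x by (rule pullback_twice_differentiable)
  have H: "linear H"
    unfolding H_def using metric_thess(2)[OF x h] .
  have H': "(H has_derivative H) (at s)" for s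
    using H by (intro bounded_linear_imp_has_derivative) (simp add: linear_conv_bounded_linear)
  have sym: "metric M x v (H w) = metric M x w (H v)" for v w
    using thess_self_adjoint[OF x h, of w v] by (simp add: H_def commute[of v])
  have m: "?m = (\<lambda>s. h 0 + metric M x s d + 1 / 2 * metric M x s (H s) + \<sigma> / 3 * nrm s ^ 3)"
    by (simp add: arc_model_def taylor2_def h_def d_def H_def tnorm_eq_nrm[OF x] fun_eq_iff)
  have m': "(?m has_derivative metric M x (?G s)) (at s)" for s
  proof -
    have d1: "((\<lambda>s. metric M x s d) has_derivative (\<lambda>v. metric M x v d)) (at s)"
      by (rule bounded_linear_imp_has_derivative) (rule bounded_linear_left)
    have d2: "((\<lambda>s. metric M x s (H s)) has_derivative
        (\<lambda>v. metric M x s (H v) + metric M x v (H s))) (at s)"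
      using FDERIV[OF has_derivative_ident H'] .
    have "(?m has_derivative (\<lambda>v. 0 + metric M x v d +
        1 / 2 * (metric M x s (H v) + metric M x v (H s)) + \<sigma> / 3 * (3 * nrm s * metric M x s v))) (at s)"
      unfolding m
      by (intro has_derivative_add has_derivative_mult_right has_derivative_const d1 d2
          has_derivative_nrm_cube)
    moreover have "0 + metric M x v d + 1 / 2 * (metric M x s (H v) + metric M x v (H s)) +
        \<sigma> / 3 * (3 * nrm s * metric M x s v) = metric M x (?G s) v" for v
      using sym[of s v] commute[of d v] commute[of "H s" v]
      by (simp add: add_left scaleR_left)
    ultimately show ?thesis by simp
  qed
  have fd: "frechet_derivative ?m (at s) = metric M x (?G s)" for s
    using frechet_derivative_at[OF m'] by simp
  have G: "tgrad M x ?m = ?G"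
    using sharp_unique by (simp add: tgrad_eq_sharp[OF x] fd fun_eq_iff)
  show "tgrad M x ?m s = tgrad M x (pullback f R x) 0 + thess M x (pullback f R x) 0 s +
      \<sigma> *\<^sub>R (tnorm M x s *\<^sub>R s)"
    by (simp add: G d_def H_def h_def tnorm_eq_nrm[OF x])
  have G': "(?G has_derivative (\<lambda>v. H v + \<sigma> *\<^sub>R (nrm s *\<^sub>R v + (metric M x s v / nrm s) *\<^sub>R s))) (at s)"
    using has_derivative_add[OF has_derivative_add[OF has_derivative_const H']
        has_derivative_scaleR_right[OF has_derivative_nrm_scaleR]] by simp
  show "twice_differentiable_at ?m s"
    unfolding twice_differentiable_at_def fd
  proof (intro conjI allI)
    show "\<forall>\<^sub>F y in nhds s. ?m differentiable (at y)"
      using differentiableI[OF m'] by (intro always_eventually allI)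
    show "(\<lambda>y. metric M x (?G y) v) differentiable (at s)" for v
      using bounded_linear.has_derivative[OF bounded_linear_left G'] by (rule differentiableI)
  qed
  show "thess M x ?m s v = thess M x (pullback f R x) 0 v +
      \<sigma> *\<^sub>R (tnorm M x s *\<^sub>R v + (metric M x s v / tnorm M x s) *\<^sub>R s)"
    unfolding thess_def[of M x ?m] G
    using frechet_derivative_at[OF G', symmetric]
    by (simp add: H_def h_def tnorm_eq_nrm[OF x])
qed

text \<open>The Hessian of the model at \<open>s\<close> exceeds that of the pullback at 0 by a form
  that Cauchy-Schwarz bounds by \<open>2 * \<sigma> * tnorm M x s\<close> times the metric.
  Subtracting it from the tested eigenvalue bound gives the constant
  \<open>\<theta> + 2 * \<sigma>\<close>.\<close>

lemma hessian_bound_of_second_order_progress: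
  assumes x: "x \<in> points M" and "\<sigma> \<ge> 0" and progress: "second_order_progress M R f \<theta> x \<sigma> s"
  shows "- (\<theta> + 2 * \<sigma>) * tnorm M x s * metric M x v v \<le> metric M x (thess M x (pullback f R x) 0 v) v"
proof -
  interpret inner_form "metric M x" using x by (rule inner_form_metric)
  let ?m = "arc_model M R f x \<sigma>" and ?n = "nrm s"
  note m = arc_model_twice_differentiable[OF x, of \<sigma> s]
  have "lambda_min (thess M x ?m s) * metric M x v v \<le> metric M x (thess M x ?m s v) v"
    by (rule lambda_min_le[OF metric_thess(2)[OF x m] thess_self_adjoint[OF x m]])
  moreover have "- \<theta> * ?n * metric M x v v \<le> lambda_min (thess M x ?m s) * metric M x v v"
    using progress nonneg[of v]
    by (intro mult_right_mono) (simp_all add: second_order_progress_def tnorm_eq_nrm[OF x])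
  moreover have "metric M x (thess M x ?m s v) v = metric M x (thess M x (pullback f R x) 0 v) v +
      \<sigma> * (?n * metric M x v v + (metric M x s v)\<^sup>2 / ?n)"
    by (simp add: thess_arc_model[OF x] tnorm_eq_nrm[OF x] add_left scaleR_left power2_eq_square)
  moreover have "\<sigma> * ((metric M x s v)\<^sup>2 / ?n) \<le> \<sigma> * (?n * metric M x v v)"
  proof (rule mult_left_mono[OF _ \<open>\<sigma> \<ge> 0\<close>])
    have "\<bar>metric M x s v\<bar> \<le> ?n * nrm v"
      using cauchy_schwarz[of s v] cauchy_schwarz[of "- s" v] by (simp add: minus_left nrm_minus)
    then have "(metric M x s v)\<^sup>2 \<le> (?n * nrm v)\<^sup>2"
      by (metis abs_ge_zero power2_abs power_mono)
    also have "\<dots> = ?n * (?n * metric M x v v)"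
      by (simp add: power_mult_distrib nrm_square[of v] power2_eq_square[of ?n])
    finally show "(metric M x s v)\<^sup>2 / ?n \<le> ?n * metric M x v v"
      by (intro divide_le_if_le_mult nrm_nonneg mult_nonneg_nonneg nonneg)
  qed
  ultimately show ?thesis
    by (simp add: tnorm_eq_nrm[OF x] algebra_simps)
qed

text \<open>In the denominator of the ratio the added cubic term cancels that of the model, leaving
  \<open>D\<close>, and model decrease says that \<open>D\<close> is at least
  \<open>\<sigma> / 3 * tnorm M x s ^ 3\<close>. This gives the decrease at once. For a large weight
  it also makes the error \<open>L / 6 * tnorm M x s ^ 3\<close> at most
  \<open>(1 - \<eta>) * D\<close>, which is a ratio of at least \<open>\<eta>\<close>.\<close>

lemma
  assumes x: "x \<in> points M" and "s \<noteq> 0" and "\<sigma> > 0"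
    and progress: "first_order_progress M R f \<theta> x \<sigma> s"
  shows successful_decrease: "0 < \<eta> \<Longrightarrow> \<eta> \<le> arc_ratio M R f x \<sigma> s \<Longrightarrow>
      \<eta> * (\<sigma> / 3) * tnorm M x s ^ 3 \<le> f x - f (R x s)"
    and very_successful: "\<eta> < 1 \<Longrightarrow> L / (2 * (1 - \<eta>)) \<le> \<sigma> \<Longrightarrow>
      pullback f R x s - taylor2 M x (pullback f R x) s \<le> L / 6 * tnorm M x s ^ 3 \<Longrightarrow>
      \<eta> \<le> arc_ratio M R f x \<sigma> s"
proof -
  interpret inner_form "metric M x" using x by (rule inner_form_metric)
  let ?n3 = "tnorm M x s ^ 3"
  let ?t = "taylor2 M x (pullback f R x) s"
  define D where "D = f x - ?t"
  have n3: "?n3 > 0"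
    using tnorm_nonneg[OF x, of s] tnorm_eq_0_iff[OF x, of s] \<open>s \<noteq> 0\<close> by simp
  have m0: "arc_model M R f x \<sigma> 0 = f x"
    by (simp add: arc_model_def taylor2_def zero_left tnorm_eq_nrm[OF x] pullback_def R_zero[OF x])
  have "D \<ge> \<sigma> / 3 * ?n3"
    using progress m0 by (simp add: first_order_progress_def D_def arc_model_def)
  moreover have "\<sigma> / 3 * ?n3 > 0"
    using n3 \<open>\<sigma> > 0\<close> by simp
  ultimately have "D > 0" by linarith
  have ratio: "arc_ratio M R f x \<sigma> s = (f x - f (R x s)) / D"
    unfolding arc_ratio_def m0 D_def by (simp add: arc_model_def)
  show "\<eta> * (\<sigma> / 3) * ?n3 \<le> f x - f (R x s)"
    if "0 < \<eta>" "\<eta> \<le> arc_ratio M R f x \<sigma> s"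
  proof -
    have "\<eta> * (\<sigma> / 3 * ?n3) \<le> \<eta> * D"
      using \<open>D \<ge> \<sigma> / 3 * ?n3\<close> that(1) by (intro mult_left_mono) auto
    also have "\<dots> \<le> f x - f (R x s)"
      using that(2) \<open>D > 0\<close> by (simp add: ratio pos_le_divide_eq)
    finally show ?thesis
      by (simp add: mult.assoc)
  qed
  show "\<eta> \<le> arc_ratio M R f x \<sigma> s"
    if "\<eta> < 1" "L / (2 * (1 - \<eta>)) \<le> \<sigma>" "pullback f R x s - ?t \<le> L / 6 * ?n3"
  proof -
    have "L \<le> \<sigma> * (2 * (1 - \<eta>))"
      using that(1,2) by (simp add: pos_divide_le_eq)
    then have "L / 6 * ?n3 \<le> (1 - \<eta>) * (\<sigma> / 3) * ?n3"
      using n3 by (intro mult_right_mono) (simp_all add: field_simps)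
    also have "\<dots> \<le> (1 - \<eta>) * D"
      using mult_left_mono[OF \<open>D \<ge> \<sigma> / 3 * ?n3\<close>, of "1 - \<eta>"] that(1) by (simp add: mult.assoc)
    finally have "f (R x s) - ?t \<le> (1 - \<eta>) * D"
      using that(3) by (simp add: pullback_def)
    then have "\<eta> * D \<le> f x - f (R x s)"
      by (simp add: D_def algebra_simps)
    then show ?thesis
      using \<open>D > 0\<close> by (simp add: ratio pos_le_divide_eq)
  qed
qed

text \<open>At \<open>s\<close> the gradient of the pullback is the gradient of the model, minus its
  cubic part, plus the error of the linearised gradient.\<close>

lemma gradient_bound_of_first_order_progress:
  assumes x: "x \<in> points M" and "\<sigma> \<ge> 0"
    and progress: "first_order_progress M R f \<theta> x \<sigma> s"
  shows "tnorm M x (tgrad M x (pullback f R x) s) \<le> (\<theta> + \<sigma>) * (tnorm M x s)\<^sup>2 +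
    tnorm M x (tgrad M x (pullback f R x) s - tgrad M x (pullback f R x) 0 - thess M x (pullback f R x) 0 s)"
proof -
  interpret inner_form "metric M x" using x by (rule inner_form_metric)
  let ?g = "tgrad M x (pullback f R x)" and ?H = "thess M x (pullback f R x) 0 s"
  let ?Gm = "tgrad M x (arc_model M R f x \<sigma>) s" and ?r = "\<sigma> *\<^sub>R (nrm s *\<^sub>R s)"
  have "?g s = (?g s - ?g 0 - ?H) + (?Gm + (- ?r))"
    by (simp add: tgrad_arc_model[OF x] tnorm_eq_nrm[OF x])
  then have "nrm (?g s) = nrm ((?g s - ?g 0 - ?H) + (?Gm + (- ?r)))"
    by (rule arg_cong)
  also have "\<dots> \<le> nrm (?g s - ?g 0 - ?H) + nrm (?Gm + (- ?r))"
    by (rule nrm_add)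
  also have "\<dots> \<le> nrm (?g s - ?g 0 - ?H) + (nrm ?Gm + nrm (- ?r))"
    by (intro add_left_mono nrm_add)
  finally have "nrm (?g s) \<le> nrm (?g s - ?g 0 - ?H) + (nrm ?Gm + nrm (- ?r))" .
  moreover have "nrm ?Gm \<le> \<theta> * (nrm s)\<^sup>2"
    using progress by (simp add: first_order_progress_def tnorm_eq_nrm[OF x])
  moreover have "nrm (- ?r) = \<sigma> * (nrm s)\<^sup>2"
    using \<open>\<sigma> \<ge> 0\<close> by (simp add: nrm_minus nrm_scaleR power2_eq_square)
  ultimately show ?thesis
    by (simp add: tnorm_eq_nrm[OF x] distrib_right)
qed

text \<open>For a zero trial step the gradient test has right-hand side 0, and the gradient of the
  model is \<open>rgrad M f x\<close>.\<close>

lemma rgrad_zero_of_first_order_progress: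
  assumes x: "x \<in> points M" and progress: "first_order_progress M R f \<theta> x \<sigma> 0"
  shows "rgrad M f x = 0"
proof -
  interpret inner_form "metric M x" using x by (rule inner_form_metric)
  let ?Gm = "tgrad M x (arc_model M R f x \<sigma>) 0"
  have "linear (thess M x (pullback f R x) 0)"
    by (rule metric_thess(2)[OF x pullback_twice_differentiable[OF x]])
  then have "?Gm = rgrad M f x"
    by (simp add: tgrad_arc_model[OF x] tgrad_pullback_zero[OF x] linear_0)
  moreover have "tnorm M x ?Gm \<le> 0"
    using progress by (simp add: first_order_progress_def tnorm_eq_nrm[OF x])
  ultimately show ?thesis
    using tnorm_nonneg[OF x, of ?Gm] tnorm_eq_0_iff[OF x, of ?Gm] by simp
qed

end

section \<open>Counting iterations\<close>

text \<open>The map from an element of \<open>T\<close> outside \<open>B\<close> to its successor in \<open>T\<close> is injective into \<open>B\<close>.\<close>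

lemma card_le_if_no_consecutive_outside:
  fixes T B :: "nat set"
  assumes fin: "finite T" and B: "B \<subseteq> T"
    and no_pair: "\<And>i j. i \<in> T - B \<Longrightarrow> j \<in> T - B \<Longrightarrow> i < j \<Longrightarrow> \<exists>l\<in>T. i < l \<and> l < j"
  shows "card T \<le> 2 * card B + 1"
proof (cases "T = {}")
  case False
  define nxt where "nxt i = (LEAST j. j \<in> T \<and> i < j)" for i
  \<comment> \<open>\<open>Max T\<close> has no successor in \<open>T\<close>; leaving it out
    accounts for the \<open>+ 1\<close> of the bound.\<close>
  let ?A = "T - B - {Max T}"
  have nxt: "nxt i \<in> T" "i < nxt i" "\<And>l. l \<in> T \<Longrightarrow> i < l \<Longrightarrow> nxt i \<le> l" if "i \<in> ?A" for i
  proof -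
    have "Max T \<in> T \<and> i < Max T"
      using that fin False by (auto simp: le_neq_implies_less)
    then have "nxt i \<in> T \<and> i < nxt i"
      unfolding nxt_def by (rule LeastI)
    then show "nxt i \<in> T" "i < nxt i" by auto
    show "nxt i \<le> l" if "l \<in> T" "i < l" for l
      unfolding nxt_def using that by (intro Least_le) simp
  qed
  have "inj_on nxt ?A"
  proof (rule inj_onI)
    fix i j assume ij: "i \<in> ?A" "j \<in> ?A" "nxt i = nxt j"
    show "i = j"
    proof (rule ccontr)
      assume "i \<noteq> j"
      then consider "i < j" | "j < i" by linarith
      then show False
      proof cases
        case 1
        then show False
          using nxt(3)[OF ij(1), of j] nxt(2)[OF ij(2)] ij by auto
      next
        case 2
        then show False
          using nxt(3)[OF ij(2), of i] nxt(2)[OF ij(1)] ij by auto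
      qed
    qed
  qed
  moreover have "nxt ` ?A \<subseteq> B"
  proof (intro image_subsetI, rule ccontr)
    fix i assume i: "i \<in> ?A" and "nxt i \<notin> B"
    then have "nxt i \<in> T - B" using nxt(1) by blast
    then obtain l where "l \<in> T" "i < l" "l < nxt i"
      using no_pair[of i "nxt i"] i nxt(2) by blast
    then show False
      using nxt(3)[OF i, of l] by simp
  qed
  ultimately have "card ?A \<le> card B"
    using finite_subset[OF B fin] by (metis card_inj_on_le)
  moreover have "card (T - B) \<le> card ?A + 1"
    using diff_card_le_card_Diff[of "{Max T}" "T - B"] by simp
  moreover have "card T = card (T - B) + card B"
    using B fin by (metis card_Diff_subset card_mono finite_subset le_add_diff_inverse2)
  ultimately show ?thesis by linarith
qed simp

text \<open>\<open>ln (\<sigma> k)\<close> rises by at least \<open>ln \<gamma>2\<close> at a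
  failure and falls by at most \<open>ln (1 / \<gamma>1)\<close> at a success, while its total rise
  is at most \<open>ln (\<sigma>max / \<sigma>min)\<close>.\<close>

lemma card_unsuccessful_le:
  fixes \<sigma> :: "nat \<Rightarrow> real"
  assumes pos: "\<sigma>min > 0" and \<gamma>: "0 < \<gamma>1" "\<gamma>1 < 1" "1 < \<gamma>2"
    and bounds: "\<And>k. k \<le> K \<Longrightarrow> \<sigma>min \<le> \<sigma> k \<and> \<sigma> k \<le> \<sigma>max"
    and step: "\<And>k. k < K \<Longrightarrow> (if P k then \<gamma>1 else \<gamma>2) * \<sigma> k \<le> \<sigma> (Suc k)"
  shows "real (card {k\<in>{..<K}. \<not> P k}) * ln \<gamma>2 \<le>
    ln (\<sigma>max / \<sigma>min) + real (card {k\<in>{..<K}. P k}) * ln (1 / \<gamma>1)"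
proof -
  have \<sigma>: "\<sigma> k > 0" if "k \<le> K" for k
    using bounds[OF that] pos by linarith
  have "(\<Sum>k<K. if P k then - ln (1 / \<gamma>1) else ln \<gamma>2) \<le> (\<Sum>k<K. ln (\<sigma> (Suc k)) - ln (\<sigma> k))"
  proof (rule sum_mono)
    fix k assume "k \<in> {..<K}"
    then have k: "k < K" by simp
    have "ln ((if P k then \<gamma>1 else \<gamma>2) * \<sigma> k) \<le> ln (\<sigma> (Suc k))"
      using step[OF k] \<sigma>[of k] \<sigma>[of "Suc k"] \<gamma> k by (subst ln_le_cancel_iff) auto
    then show "(if P k then - ln (1 / \<gamma>1) else ln \<gamma>2) \<le> ln (\<sigma> (Suc k)) - ln (\<sigma> k)"
      using \<sigma>[of k] \<gamma> k by (auto simp: ln_mult ln_div split: if_splits)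
  qed
  also have "\<dots> = ln (\<sigma> K) - ln (\<sigma> 0)"
    by (rule sum_lessThan_telescope)
  also have "\<dots> \<le> ln \<sigma>max - ln \<sigma>min"
    using bounds[of K] bounds[of 0] \<sigma>[of K] \<sigma>[of 0] pos
    by (intro diff_mono) (auto simp: ln_le_cancel_iff)
  also have "\<dots> = ln (\<sigma>max / \<sigma>min)"
    using bounds[of 0] pos by (subst ln_div) auto
  also have "(\<Sum>k<K. if P k then - ln (1 / \<gamma>1) else ln \<gamma>2) =
      real (card {k\<in>{..<K}. \<not> P k}) * ln \<gamma>2 - real (card {k\<in>{..<K}. P k}) * ln (1 / \<gamma>1)"
    by (subst sum.If_cases) (simp_all add: Int_def conj_commute Collect_neg_eq[symmetric])
  finally show ?thesis by linarith
qed

text \<open>\<open>P\<close> marks success, \<open>n\<close> is the step length,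
  \<open>\<phi>\<close> the objective. Without the desired pair there are at most
  \<open>2 * (E / (\<kappa> * \<delta> ^ 3)) + 1\<close> successes, each paying for at most
  \<open>ln (1 / \<gamma>1) / ln \<gamma>2\<close> failures beyond the initial allowance
  \<open>ln (\<sigma>max / \<sigma>min) / ln \<gamma>2\<close>. The threshold for \<open>K\<close>
  is the resulting total.\<close>

lemma consecutive_small_steps:
  fixes \<sigma> n \<phi> :: "nat \<Rightarrow> real"
  assumes pos: "\<sigma>min > 0" and \<gamma>: "0 < \<gamma>1" "\<gamma>1 < 1" "1 < \<gamma>2" and "\<kappa> > 0" "\<delta> > 0"
    and bounds: "\<And>k. k \<le> K \<Longrightarrow> \<sigma>min \<le> \<sigma> k \<and> \<sigma> k \<le> \<sigma>max"
    and step: "\<And>k. k < K \<Longrightarrow> (if P k then \<gamma>1 else \<gamma>2) * \<sigma> k \<le> \<sigma> (Suc k)"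
    and decrease: "\<And>k. k < K \<Longrightarrow> P k \<Longrightarrow> \<kappa> * n k ^ 3 \<le> \<phi> k - \<phi> (Suc k)"
    and unchanged: "\<And>k. k < K \<Longrightarrow> \<not> P k \<Longrightarrow> \<phi> (Suc k) = \<phi> k"
    and n: "\<And>k. k < K \<Longrightarrow> n k \<ge> 0"
    and E: "\<phi> 0 - \<phi> K \<le> E"
    and K: "real K > ln (\<sigma>max / \<sigma>min) / ln \<gamma>2 +
      (1 + ln (1 / \<gamma>1) / ln \<gamma>2) * (2 * (E / (\<kappa> * \<delta> ^ 3)) + 1)"
  shows "\<exists>i j. i < j \<and> j < K \<and> P i \<and> P j \<and> (\<forall>l. i < l \<and> l < j \<longrightarrow> \<not> P l) \<and> n i < \<delta> \<and> n j < \<delta>"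
proof (rule ccontr)
  assume none: "\<not> ?thesis"
  define T where "T = {k\<in>{..<K}. P k}"
  define B where "B = {k\<in>T. n k \<ge> \<delta>}"
  have fin: "finite T" and B: "B \<subseteq> T"
    by (auto simp: T_def B_def)
  have T: "card T \<le> 2 * card B + 1"
  proof (rule card_le_if_no_consecutive_outside[OF fin B])
    fix i j assume "i \<in> T - B" "j \<in> T - B" "i < j"
    then show "\<exists>l\<in>T. i < l \<and> l < j"
      using none unfolding T_def B_def by (auto simp: not_le) (meson less_trans)
  qed
  \<comment> \<open>Each long success spends at least \<open>\<kappa> * \<delta> ^ 3\<close> of the
    total decrease; every other iteration spends at least 0.\<close>
  have "real (card B) * (\<kappa> * \<delta> ^ 3) = (\<Sum>k<K. if k \<in> B then \<kappa> * \<delta> ^ 3 else 0)"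
  proof -
    have "{..<K} \<inter> B = B"
      by (auto simp: B_def T_def)
    then show ?thesis
      by (simp add: sum.If_cases)
  qed
  also have "\<dots> \<le> (\<Sum>k<K. \<phi> k - \<phi> (Suc k))"
  proof (rule sum_mono)
    fix k assume "k \<in> {..<K}"
    then have k: "k < K" by simp
    show "(if k \<in> B then \<kappa> * \<delta> ^ 3 else 0) \<le> \<phi> k - \<phi> (Suc k)"
    proof (cases "P k")
      case True
      have "(if k \<in> B then \<kappa> * \<delta> ^ 3 else 0) \<le> \<kappa> * n k ^ 3"
        using \<open>\<kappa> > 0\<close> \<open>\<delta> > 0\<close> n[OF k] by (auto simp: B_def intro!: power_mono)
      with decrease[OF k True] show ?thesis by linarith
    next
      case False
      then show ?thesis
        using unchanged[OF k] by (simp add: B_def T_def)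
    qed
  qed
  also have "\<dots> = \<phi> 0 - \<phi> K"
    by (rule sum_lessThan_telescope')
  finally have "real (card B) \<le> E / (\<kappa> * \<delta> ^ 3)"
    using E \<open>\<kappa> > 0\<close> \<open>\<delta> > 0\<close> by (simp add: pos_le_divide_eq)
  with T have T': "real (card T) \<le> 2 * (E / (\<kappa> * \<delta> ^ 3)) + 1"
    by linarith
  have ln: "ln \<gamma>2 > 0" "ln (1 / \<gamma>1) > 0"
    using \<gamma> by (auto simp: ln_gt_zero_iff)
  let ?U = "{k\<in>{..<K}. \<not> P k}"
  have "real (card ?U) * ln \<gamma>2 \<le> ln (\<sigma>max / \<sigma>min) + real (card T) * ln (1 / \<gamma>1)"
    unfolding T_def using pos \<gamma> bounds step by (rule card_unsuccessful_le)
  then have U: "real (card ?U) \<le> ln (\<sigma>max / \<sigma>min) / ln \<gamma>2 + real (card T) * (ln (1 / \<gamma>1) / ln \<gamma>2)"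
    using ln by (simp add: field_simps)
  have "{..<K} = T \<union> ?U" "T \<inter> ?U = {}"
    by (auto simp: T_def)
  then have "card {..<K} = card T + card ?U"
    using fin by (metis (no_types, lifting) card_Un_disjoint finite_Un finite_lessThan)
  then have "real K = real (card T) + real (card ?U)"
    by simp
  also have "\<dots> \<le> ln (\<sigma>max / \<sigma>min) / ln \<gamma>2 + (1 + ln (1 / \<gamma>1) / ln \<gamma>2) * real (card T)"
  proof -
    have "(1 + c) * t = t + t * c" for c t :: real
      by (simp add: algebra_simps)
    then show ?thesis
      using U by simp
  qed
  also have "\<dots> \<le> ln (\<sigma>max / \<sigma>min) / ln \<gamma>2 +
      (1 + ln (1 / \<gamma>1) / ln \<gamma>2) * (2 * (E / (\<kappa> * \<delta> ^ 3)) + 1)"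
    using T' ln by (intro add_left_mono mult_left_mono) auto
  finally show False
    using K by linarith
qed

section \<open>Complexity of the algorithm\<close>

locale arc_iteration = riem_objective M R f
  for M :: "('m, 'e::euclidean_space) riem" and R :: "'m \<Rightarrow> 'e \<Rightarrow> 'm" and f :: "'m \<Rightarrow> real" +
  fixes x0 :: 'm and x :: "nat \<Rightarrow> 'm" and s :: "nat \<Rightarrow> 'e" and \<sigma> :: "nat \<Rightarrow> real"
    and \<theta> \<sigma>min \<eta>1 \<eta>2 \<gamma>1 \<gamma>2 \<gamma>3 L :: real
  assumes x0: "x0 \<in> points M"
    and params: "arc_params \<theta> \<sigma>min \<eta>1 \<eta>2 \<gamma>1 \<gamma>2 \<gamma>3"
    and run: "arc_run M R f \<theta> \<sigma>min \<eta>1 \<eta>2 \<gamma>1 \<gamma>2 \<gamma>3 x0 x s \<sigma>"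
    and model_bound: "\<And>k. reached s k \<Longrightarrow>
      pullback f R (x k) (s k) - taylor2 M (x k) (pullback f R (x k)) (s k)
        \<le> L / 6 * tnorm M (x k) (s k) ^ 3"
begin

abbreviation \<rho> :: "nat \<Rightarrow> real" where
  "\<rho> k \<equiv> arc_ratio M R f (x k) (\<sigma> k) (s k)"

abbreviation step_size :: "nat \<Rightarrow> real" where
  "step_size k \<equiv> tnorm M (x k) (s k)"

lemma parameters:
  "\<theta> > 0" "\<sigma>min > 0" "0 < \<eta>1" "\<eta>1 \<le> \<eta>2" "\<eta>2 < 1" "0 < \<gamma>1" "\<gamma>1 < 1" "1 < \<gamma>2" "\<gamma>2 < \<gamma>3"
  using params by (auto simp: arc_params_def)

lemma reached_Suc: "reached s (Suc k) \<longleftrightarrow> reached s k \<and> s k \<noteq> 0"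
  by (auto simp: reached_def less_Suc_eq)

lemma reached_mono: "reached s K \<Longrightarrow> k \<le> K \<Longrightarrow> reached s k"
  by (auto simp: reached_def)

lemma progress: "reached s k \<Longrightarrow> first_order_progress M R f \<theta> (x k) (\<sigma> k) (s k)"
  using run by (simp add: arc_run_def)

text \<open>\<open>reached s (Suc k)\<close> says that iteration \<open>k\<close> takes place and
  does not terminate, which is the guard of the update rules in \<open>arc_run\<close>.\<close>

lemma update:
  assumes "reached s (Suc k)"
  shows "x (Suc k) = (if \<rho> k \<ge> \<eta>1 then R (x k) (s k) else x k)"
    and "\<rho> k \<ge> \<eta>2 \<Longrightarrow> max \<sigma>min (\<gamma>1 * \<sigma> k) \<le> \<sigma> (Suc k) \<and> \<sigma> (Suc k) \<le> \<sigma> k"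
    and "\<eta>1 \<le> \<rho> k \<Longrightarrow> \<rho> k < \<eta>2 \<Longrightarrow> \<sigma> k \<le> \<sigma> (Suc k) \<and> \<sigma> (Suc k) \<le> \<gamma>2 * \<sigma> k"
    and "\<rho> k < \<eta>1 \<Longrightarrow> \<gamma>2 * \<sigma> k \<le> \<sigma> (Suc k) \<and> \<sigma> (Suc k) \<le> \<gamma>3 * \<sigma> k"
  using run assms by (auto simp: arc_run_def reached_Suc Let_def)

lemma x_in_points: "reached s k \<Longrightarrow> x k \<in> points M"
proof (induction k)
  case 0
  then show ?case using run x0 by (simp add: arc_run_def)
next
  case (Suc k)
  then show ?case
    using update(1)[OF Suc.prems] R_in_points by (auto simp: reached_Suc)
qed

lemma \<sigma>_step_lower:
  assumes "reached s (Suc k)" "\<sigma>min \<le> \<sigma> k"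
  shows "(if \<eta>1 \<le> \<rho> k then \<gamma>1 else \<gamma>2) * \<sigma> k \<le> \<sigma> (Suc k)" and "\<sigma>min \<le> \<sigma> (Suc k)"
proof -
  have "\<gamma>1 * \<sigma> k \<le> 1 * \<sigma> k" "1 * \<sigma> k \<le> \<gamma>2 * \<sigma> k"
    using parameters assms(2) by (intro mult_right_mono; linarith)+
  then have "(if \<eta>1 \<le> \<rho> k then \<gamma>1 else \<gamma>2) * \<sigma> k \<le> \<sigma> (Suc k) \<and> \<sigma>min \<le> \<sigma> (Suc k)"
    using update(2-4)[OF assms(1)] assms(2) parameters(4)
    by (cases "\<rho> k \<ge> \<eta>2"; cases "\<rho> k \<ge> \<eta>1") auto
  then show "(if \<eta>1 \<le> \<rho> k then \<gamma>1 else \<gamma>2) * \<sigma> k \<le> \<sigma> (Suc k)" "\<sigma>min \<le> \<sigma> (Suc k)"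
    by blast+
qed

lemma \<sigma>_lower: "reached s k \<Longrightarrow> \<sigma>min \<le> \<sigma> k"
proof (induction k)
  case 0
  then show ?case using run by (simp add: arc_run_def)
next
  case (Suc k)
  then show ?case
    using \<sigma>_step_lower(2) by (simp add: reached_Suc)
qed

text \<open>By \<open>very_successful\<close> a weight of at least
  \<open>L / (2 * (1 - \<eta>2))\<close> forces a ratio of at least \<open>\<eta>2\<close>. An
  increase thus starts below this value and multiplies by at most \<open>\<gamma>3\<close>.\<close>

definition \<sigma>max :: real where
  "\<sigma>max = max (\<sigma> 0) (\<gamma>3 * (L / (2 * (1 - \<eta>2))))"

lemma \<sigma>_upper: "reached s k \<Longrightarrow> \<sigma> k \<le> \<sigma>max"
proof (induction k)
  case 0
  then show ?case by (simp add: \<sigma>max_def)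
next
  case (Suc k)
  then have k: "reached s k" "s k \<noteq> 0" by (auto simp: reached_Suc)
  have \<sigma>: "\<sigma> k > 0" using \<sigma>_lower[OF k(1)] parameters by linarith
  show ?case
  proof (cases "\<eta>2 \<le> \<rho> k")
    case True
    then show ?thesis
      using update(2)[OF Suc.prems] Suc.IH[OF k(1)] by linarith
  next
    case False
    then have "\<sigma> k \<le> L / (2 * (1 - \<eta>2))"
      using very_successful[OF x_in_points[OF k(1)] k(2) \<sigma> progress[OF k(1)] parameters(5) _
          model_bound[OF k(1)]] by linarith
    then have "\<gamma>3 * \<sigma> k \<le> \<gamma>3 * (L / (2 * (1 - \<eta>2)))"
      using parameters by (intro mult_left_mono) auto
    moreover have "\<gamma>2 * \<sigma> k \<le> \<gamma>3 * \<sigma> k"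
      using parameters \<sigma> by (intro mult_right_mono) auto
    ultimately have "\<sigma> (Suc k) \<le> \<gamma>3 * (L / (2 * (1 - \<eta>2)))"
      using update(3,4)[OF Suc.prems] False by linarith
    then show ?thesis by (simp add: \<sigma>max_def)
  qed
qed

lemma decrease:
  assumes "reached s (Suc k)" "\<eta>1 \<le> \<rho> k"
  shows "\<eta>1 * \<sigma>min / 3 * step_size k ^ 3 \<le> f (x k) - f (x (Suc k))"
proof -
  have k: "reached s k" "s k \<noteq> 0" using assms(1) by (auto simp: reached_Suc)
  have \<sigma>: "\<sigma> k > 0" using \<sigma>_lower[OF k(1)] parameters by linarith
  have "\<eta>1 * \<sigma>min / 3 * step_size k ^ 3 \<le> \<eta>1 * (\<sigma> k / 3) * step_size k ^ 3"
    using \<sigma>_lower[OF k(1)] parameters tnorm_nonneg[OF x_in_points[OF k(1)]]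
    by (intro mult_right_mono) auto
  also have "\<dots> \<le> f (x k) - f (R (x k) (s k))"
    by (rule successful_decrease[OF x_in_points[OF k(1)] k(2) \<sigma> progress[OF k(1)] parameters(3) assms(2)])
  finally show ?thesis
    using update(1)[OF assms(1)] assms(2) by simp
qed

lemma unsuccessful: "reached s (Suc k) \<Longrightarrow> \<not> \<eta>1 \<le> \<rho> k \<Longrightarrow> x (Suc k) = x k"
  using update(1) by simp

lemma monotone: "reached s k \<Longrightarrow> f (x k) \<le> f x0"
proof (induction k)
  case 0
  then show ?case using run by (simp add: arc_run_def)
next
  case (Suc k)
  then have k: "reached s k" by (simp add: reached_Suc)
  have "0 \<le> \<eta>1 * \<sigma>min / 3 * step_size k ^ 3"
    using parameters tnorm_nonneg[OF x_in_points[OF k]] by simp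
  then have "f (x (Suc k)) \<le> f (x k)"
    using decrease[OF Suc.prems] unsuccessful[OF Suc.prems] by (cases "\<eta>1 \<le> \<rho> k") auto
  then show ?case
    using Suc.IH[OF k] by linarith
qed

lemma between_successful:
  assumes "i < j" "reached s j" "\<eta>1 \<le> \<rho> i" and none: "\<And>l. i < l \<Longrightarrow> l < j \<Longrightarrow> \<not> \<eta>1 \<le> \<rho> l"
  shows "x j = R (x i) (s i)"
proof -
  have "x m = x (Suc i)" if "Suc i \<le> m" "m \<le> j" for m
    using that
  proof (induction m rule: dec_induct)
    case base
    then show ?case by simp
  next
    case (step l)
    then have "\<not> \<eta>1 \<le> \<rho> l"
      by (intro none) auto
    then have "x (Suc l) = x l"
      using step by (intro unsuccessful reached_mono[OF assms(2)]) auto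
    then show ?case
      using step by simp
  qed
  moreover have "x (Suc i) = R (x i) (s i)"
    using update(1)[OF reached_mono[OF assms(2)], of i] assms(1,3) by simp
  ultimately show ?thesis
    using assms(1) by simp
qed

text \<open>With \<open>s k = 0\<close> the bounds on gradient and curvature lose their error terms,
  so criticality is exact.\<close>

lemma terminated:
  assumes "reached s k" "s k = 0"
  shows "rgrad M f (x k) = 0"
    and "second_order_progress M R f \<theta> (x k) (\<sigma> k) (s k) \<Longrightarrow> second_order_retraction M R \<Longrightarrow>
      lambda_min (rhess M f (x k)) \<ge> 0"
proof -
  note xk = x_in_points[OF assms(1)]
  show "rgrad M f (x k) = 0"
    using progress[OF assms(1)] assms(2) by (intro rgrad_zero_of_first_order_progress[OF xk]) simp
  assume *: "second_order_progress M R f \<theta> (x k) (\<sigma> k) (s k)" and R2: "second_order_retraction M R"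
  show "lambda_min (rhess M f (x k)) \<ge> 0"
    using hessian_bound_of_second_order_progress[OF xk _ *] \<sigma>_lower[OF assms(1)] parameters assms(2)
      tnorm_eq_0_iff[OF xk, of 0]
    by (intro lambda_min_rhess_ge[OF xk R2]) simp
qed

lemma hessian_lower:
  assumes k: "reached s k" and "second_order_progress M R f \<theta> (x k) (\<sigma> k) (s k)"
    and "second_order_retraction M R"
  shows "- ((\<theta> + 2 * \<sigma>max) * step_size k) \<le> lambda_min (rhess M f (x k))"
proof -
  note xk = x_in_points[OF k]
  have "\<sigma> k \<ge> 0"
    using \<sigma>_lower[OF k] parameters by linarith
  then have "- (\<theta> + 2 * \<sigma> k) * step_size k \<le> lambda_min (rhess M f (x k))"
    by (intro lambda_min_rhess_ge[OF xk assms(3)]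
        hessian_bound_of_second_order_progress[OF xk _ assms(2)])
  moreover have "(\<theta> + 2 * \<sigma> k) * step_size k \<le> (\<theta> + 2 * \<sigma>max) * step_size k"
    using \<sigma>_upper[OF k] tnorm_nonneg[OF xk] by (intro mult_right_mono) auto
  ultimately show ?thesis by linarith
qed

text \<open>A short successful step makes \<open>q\<close> small enough for its term to be absorbed on the left.\<close>

lemma next_gradient_bound:
  assumes k: "reached s k" and "b > 0" and q: "q (step_size k) \<le> b / 2"
    and \<sigma>: "sigma_min M (x k) (R (x k) (s k)) (D_retr M R (x k) (s k)) \<ge> b"
    and grad: "tnorm M (x k) (tgrad M (x k) (pullback f R (x k)) (s k)
          - tgrad M (x k) (pullback f R (x k)) 0 - thess M (x k) (pullback f R (x k)) 0 (s k))
        \<le> L' / 2 * (step_size k)\<^sup>2 + q (step_size k) * tnorm M (R (x k) (s k)) (rgrad M f (R (x k) (s k)))"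
  shows "b / 2 * tnorm M (R (x k) (s k)) (rgrad M f (R (x k) (s k)))
    \<le> (\<bar>L'\<bar> + \<theta> + \<sigma>max) * (step_size k)\<^sup>2"
proof -
  note xk = x_in_points[OF k]
  let ?N = "tnorm M (R (x k) (s k)) (rgrad M f (R (x k) (s k)))"
  have "b * ?N \<le> tnorm M (x k) (tgrad M (x k) (pullback f R (x k)) (s k))"
    by (rule sigma_min_gradient_bound[OF xk \<open>b > 0\<close> \<sigma>])
  also have "\<dots> \<le> (\<theta> + \<sigma> k) * (step_size k)\<^sup>2 + (L' / 2 * (step_size k)\<^sup>2 + q (step_size k) * ?N)"
    using gradient_bound_of_first_order_progress[OF xk _ progress[OF k]] \<sigma>_lower[OF k] parameters grad
    by linarith
  also have "q (step_size k) * ?N \<le> b / 2 * ?N"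
    using q tnorm_nonneg[OF R_in_points[OF xk]] by (rule mult_right_mono)
  finally have "b / 2 * ?N \<le> (L' / 2 + \<theta> + \<sigma> k) * (step_size k)\<^sup>2"
    by (simp add: algebra_simps)
  also have "\<dots> \<le> (\<bar>L'\<bar> + \<theta> + \<sigma>max) * (step_size k)\<^sup>2"
    using \<sigma>_upper[OF k] by (intro mult_right_mono) auto
  finally show ?thesis .
qed

lemma short_consecutive_steps:
  assumes K: "reached s K" and low: "\<And>y. y \<in> points M \<Longrightarrow> f y \<ge> flow" and "\<delta> > 0"
    and "real K > ln (\<sigma>max / \<sigma>min) / ln \<gamma>2 +
      (1 + ln (1 / \<gamma>1) / ln \<gamma>2) * (2 * ((f x0 - flow) / (\<eta>1 * \<sigma>min / 3 * \<delta> ^ 3)) + 1)"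
  shows "\<exists>i j. i < j \<and> j < K \<and> x j = R (x i) (s i) \<and> successful M R f \<eta>1 x s \<sigma> i \<and>
    step_size i < \<delta> \<and> step_size j < \<delta>"
proof -
  have le: "reached s k" if "k \<le> K" for k
    using reached_mono[OF K that] .
  have "\<exists>i j. i < j \<and> j < K \<and> \<eta>1 \<le> \<rho> i \<and> \<eta>1 \<le> \<rho> j \<and> (\<forall>l. i < l \<and> l < j \<longrightarrow> \<not> \<eta>1 \<le> \<rho> l) \<and>
      step_size i < \<delta> \<and> step_size j < \<delta>"
  proof (rule consecutive_small_steps[OF parameters(2) parameters(6-8) _ \<open>\<delta> > 0\<close> _ _ _ _ _ _ assms(4)])
    show "\<eta>1 * \<sigma>min / 3 > 0"
      using parameters by simp
    show "\<sigma>min \<le> \<sigma> k \<and> \<sigma> k \<le> \<sigma>max" if "k \<le> K" for k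
      using \<sigma>_lower \<sigma>_upper le[OF that] by blast
    show "(if \<eta>1 \<le> \<rho> k then \<gamma>1 else \<gamma>2) * \<sigma> k \<le> \<sigma> (Suc k)" if "k < K" for k
      using that by (intro \<sigma>_step_lower(1) \<sigma>_lower le) auto
    show "\<eta>1 * \<sigma>min / 3 * step_size k ^ 3 \<le> f (x k) - f (x (Suc k))" if "k < K" "\<eta>1 \<le> \<rho> k" for k
      using that by (intro decrease le) auto
    show "f (x (Suc k)) = f (x k)" if "k < K" "\<not> \<eta>1 \<le> \<rho> k" for k
      using that unsuccessful[of k] le[of "Suc k"] by simp
    show "step_size k \<ge> 0" if "k < K" for k
      using that by (intro tnorm_nonneg x_in_points le) auto
    show "f (x 0) - f (x K) \<le> f x0 - flow"
      using monotone[OF le[of 0]] low[OF x_in_points[OF K]] by simp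
  qed
  then obtain i j where ij: "i < j" "j < K" "\<eta>1 \<le> \<rho> i" "\<forall>l. i < l \<and> l < j \<longrightarrow> \<not> \<eta>1 \<le> \<rho> l"
    "step_size i < \<delta>" "step_size j < \<delta>" by blast
  moreover have "x j = R (x i) (s i)"
    using ij le[of j] by (intro between_successful) auto
  moreover have "successful M R f \<eta>1 x s \<sigma> i"
    using ij le[of "Suc i"] by (simp add: successful_def reached_Suc)
  ultimately show ?thesis by blast
qed

text \<open>Isolates what the choice of \<open>\<delta>\<close> must achieve: both tolerances, a
  range in which \<open>q\<close> can be absorbed, and a range in which the retraction is well
  conditioned.\<close>

lemma approximate_minimizer:
  assumes K: "reached s K" and low: "\<And>y. y \<in> points M \<Longrightarrow> f y \<ge> flow" and "\<delta> > 0" "\<epsilon> > 0" "b > 0"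
    and large: "real K > ln (\<sigma>max / \<sigma>min) / ln \<gamma>2 +
      (1 + ln (1 / \<gamma>1) / ln \<gamma>2) * (2 * ((f x0 - flow) / (\<eta>1 * \<sigma>min / 3 * \<delta> ^ 3)) + 1)"
    and \<delta>_hess: "(\<theta> + 2 * \<sigma>max) * \<delta> \<le> sqrt \<epsilon>"
    and \<delta>_grad: "(\<bar>L'\<bar> + \<theta> + \<sigma>max) * \<delta>\<^sup>2 \<le> b / 2 * \<epsilon>"
    and q: "\<And>t. 0 \<le> t \<Longrightarrow> t < \<delta> \<Longrightarrow> q t \<le> b / 2"
    and \<sigma>: "\<And>k. successful M R f \<eta>1 x s \<sigma> k \<Longrightarrow> step_size k < \<delta> \<Longrightarrow>
      sigma_min M (x k) (R (x k) (s k)) (D_retr M R (x k) (s k)) \<ge> b"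
    and grad: "\<And>k. successful M R f \<eta>1 x s \<sigma> k \<Longrightarrow>
      tnorm M (x k) (tgrad M (x k) (pullback f R (x k)) (s k)
          - tgrad M (x k) (pullback f R (x k)) 0 - thess M (x k) (pullback f R (x k)) 0 (s k))
        \<le> L' / 2 * (step_size k)\<^sup>2 + q (step_size k) * tnorm M (R (x k) (s k)) (rgrad M f (R (x k) (s k)))"
  shows "\<exists>j\<le>K. reached s j \<and> tnorm M (x j) (rgrad M f (x j)) \<le> \<epsilon> \<and>
    (second_order_progress M R f \<theta> (x j) (\<sigma> j) (s j) \<and> second_order_retraction M R \<longrightarrow>
      lambda_min (rhess M f (x j)) \<ge> - sqrt \<epsilon>)"
proof -
  obtain i j where ij: "i < j" "j < K" "x j = R (x i) (s i)" "successful M R f \<eta>1 x s \<sigma> i"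
    "step_size i < \<delta>" "step_size j < \<delta>"
    using short_consecutive_steps[OF K low \<open>\<delta> > 0\<close> large] by blast
  have i: "reached s i" and j: "reached s j"
    using reached_mono[OF K] ij by auto
  have \<sigma>max: "\<sigma>max > 0"
    using \<sigma>_upper[OF i] \<sigma>_lower[OF i] parameters by linarith
  note n_i = tnorm_nonneg[OF x_in_points[OF i], of "s i"]
  note n_j = tnorm_nonneg[OF x_in_points[OF j], of "s j"]
  have "b / 2 * tnorm M (x j) (rgrad M f (x j)) \<le> (\<bar>L'\<bar> + \<theta> + \<sigma>max) * (step_size i)\<^sup>2"
    unfolding ij(3)
    using next_gradient_bound[where q = q, OF i \<open>b > 0\<close> q[OF n_i ij(5)] \<sigma>[OF ij(4,5)] grad[OF ij(4)]] .
  also have "\<dots> \<le> (\<bar>L'\<bar> + \<theta> + \<sigma>max) * \<delta>\<^sup>2"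
    using \<sigma>max parameters n_i ij(5) by (intro mult_left_mono power_mono) auto
  also have "\<dots> \<le> b / 2 * \<epsilon>"
    by (rule \<delta>_grad)
  finally have "tnorm M (x j) (rgrad M f (x j)) \<le> \<epsilon>"
    using \<open>b > 0\<close> by simp
  moreover have "lambda_min (rhess M f (x j)) \<ge> - sqrt \<epsilon>"
    if "second_order_progress M R f \<theta> (x j) (\<sigma> j) (s j)" "second_order_retraction M R"
  proof -
    have "(\<theta> + 2 * \<sigma>max) * step_size j \<le> (\<theta> + 2 * \<sigma>max) * \<delta>"
      using \<sigma>max parameters ij(6) by (intro mult_left_mono) auto
    then show ?thesis
      using hessian_lower[OF j that] \<delta>_hess by linarith
  qed
  ultimately show ?thesis
    using ij j by (intro exI[of _ j]) auto
qed

end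

theorem theorem2:
  fixes M :: "('m, 'e::euclidean_space) riem"
    and R :: "'m \<Rightarrow> 'e \<Rightarrow> 'm" and f :: "'m \<Rightarrow> real" and x0 :: 'm
    and x :: "nat \<Rightarrow> 'm" and s :: "nat \<Rightarrow> 'e" and \<sigma> :: "nat \<Rightarrow> real"
    and \<theta> \<sigma>min \<eta>1 \<eta>2 \<gamma>1 \<gamma>2 \<gamma>3 flow L L' b :: real
    and a :: ereal and q :: "real \<Rightarrow> real"
  assumes "riemannian_manifold M"
    and "retraction_on M R"
    and "C2_function M f"
    and "x0 \<in> points M"
    and "arc_params \<theta> \<sigma>min \<eta>1 \<eta>2 \<gamma>1 \<gamma>2 \<gamma>3"
    and "arc_run M R f \<theta> \<sigma>min \<eta>1 \<eta>2 \<gamma>1 \<gamma>2 \<gamma>3 x0 x s \<sigma>"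
    and lower_bound: "\<And>y. y \<in> points M \<Longrightarrow> f y \<ge> flow"
    and model_bound: "\<And>k. reached s k \<Longrightarrow>
      pullback f R (x k) (s k) - taylor2 M (x k) (pullback f R (x k)) (s k)
        \<le> L / 6 * tnorm M (x k) (s k) ^ 3"
    and "continuous_on {0..} q" and "\<And>t. t \<ge> 0 \<Longrightarrow> q t \<ge> 0" and "q 0 = 0"
    and gradient_bound: "\<And>k. successful M R f \<eta>1 x s \<sigma> k \<Longrightarrow>
      tnorm M (x k) (tgrad M (x k) (pullback f R (x k)) (s k)
          - tgrad M (x k) (pullback f R (x k)) 0
          - thess M (x k) (pullback f R (x k)) 0 (s k))
        \<le> L' / 2 * (tnorm M (x k) (s k))\<^sup>2
          + q (tnorm M (x k) (s k)) * tnorm M (R (x k) (s k)) (rgrad M f (R (x k) (s k)))"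
    and "a > 0" and "b > 0"
    and retraction_bound: "\<And>k. successful M R f \<eta>1 x s \<sigma> k \<Longrightarrow>
      ereal (tnorm M (x k) (s k)) \<le> a \<Longrightarrow>
      sigma_min M (x k) (R (x k) (s k)) (D_retr M R (x k) (s k)) \<ge> b"
  shows "\<exists>\<epsilon>0 C p :: real. \<epsilon>0 > 0 \<and> C \<ge> 0 \<and> p \<ge> 0 \<and>
    (\<forall>\<epsilon>. 0 < \<epsilon> \<and> \<epsilon> \<le> \<epsilon>0 \<longrightarrow>
      (\<exists>k. reached s k \<and> x k \<in> points M \<and> f (x k) \<le> f x0 \<and>
        tnorm M (x k) (rgrad M f (x k)) \<le> \<epsilon> \<and>
        ((\<forall>j. reached s j \<longrightarrow> second_order_progress M R f \<theta> (x j) (\<sigma> j) (s j)) \<and>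
          second_order_retraction M R \<longrightarrow> lambda_min (rhess M f (x k)) \<ge> - sqrt \<epsilon>) \<and>
        real k \<le> C * \<epsilon> powr (-1.5) * (1 + \<bar>ln \<epsilon>\<bar>) powr p))"
proof -
  interpret arc_iteration M R f x0 x s \<sigma> \<theta> \<sigma>min \<eta>1 \<eta>2 \<gamma>1 \<gamma>2 \<gamma>3 L
    using assms by unfold_locales auto
  have reached_0: "reached s 0"
    by (simp add: reached_def)
  have \<sigma>max: "\<sigma>min \<le> \<sigma>max" "\<sigma>max > 0"
    using \<sigma>_upper[OF reached_0] \<sigma>_lower[OF reached_0] parameters by linarith+
  have x00: "f x0 - flow \<ge> 0"
    using lower_bound \<open>x0 \<in> points M\<close> by simp
  \<comment> \<open>Continuity of \<open>q\<close> at 0 gives a radius on which \<open>q\<close>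
    takes at most half of the factor \<open>b\<close>.\<close>
  obtain r1 where r1: "r1 > 0" "\<And>t. 0 \<le> t \<Longrightarrow> t < r1 \<Longrightarrow> q t \<le> b / 2"
  proof -
    have "\<exists>d>0. \<forall>t\<in>{0..}. dist t 0 < d \<longrightarrow> dist (q t) (q 0) < b / 2"
      using \<open>continuous_on {0..} q\<close> \<open>b > 0\<close> unfolding continuous_on_iff
      by (metis atLeast_iff half_gt_zero order_refl)
    then show ?thesis
      using that \<open>q 0 = 0\<close> by (fastforce simp: dist_real_def)
  qed
  \<comment> \<open>A finite radius below the possibly infinite \<open>a\<close>.\<close>
  obtain r2 :: real where r2: "r2 > 0" "ereal r2 \<le> a"
    using ereal_dense2[OF \<open>a > 0\<close>] by (auto simp: zero_ereal_def)
  define A where "A = ln (\<sigma>max / \<sigma>min) / ln \<gamma>2"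
  define B where "B = 1 + ln (1 / \<gamma>1) / ln \<gamma>2"
  define C1 where "C1 = \<bar>L'\<bar> + \<theta> + \<sigma>max"
  \<comment> \<open>With \<open>\<delta> = c * sqrt \<epsilon>\<close>, the two entries of the
    minimum meet the tolerances for curvature and for the gradient, in this order.\<close>
  define c where "c = min (1 / (\<theta> + 2 * \<sigma>max)) (sqrt (b / (2 * C1)))"
  \<comment> \<open>The second entry keeps \<open>\<delta>\<close> within \<open>r1\<close> and
    \<open>r2\<close>; the first makes \<open>\<epsilon> powr (-1.5)\<close> at least 1, so that
    additive constants can be absorbed into \<open>C\<close>.\<close>
  define \<epsilon>0 where "\<epsilon>0 = min 1 ((min r1 r2 / c)\<^sup>2)"
  define E where "E = 2 * ((f x0 - flow) / (\<eta>1 * \<sigma>min / 3 * c ^ 3))"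
  define C where "C = A + B * (E + 1) + 1"
  have C1: "C1 > 0"
    using \<sigma>max parameters by (simp add: C1_def)
  have c: "c > 0"
    using C1 \<sigma>max parameters \<open>b > 0\<close> by (simp add: c_def)
  have "A \<ge> 0" "B \<ge> 0"
    using \<sigma>max parameters by (auto simp: A_def B_def intro!: divide_nonneg_pos ln_ge_zero add_nonneg_nonneg)
  have "E \<ge> 0"
    using x00 parameters c by (simp add: E_def)
  have "\<epsilon>0 > 0"
    using r1 r2 c by (simp add: \<epsilon>0_def)
  moreover have "C \<ge> 0"
    using \<open>A \<ge> 0\<close> \<open>B \<ge> 0\<close> \<open>E \<ge> 0\<close> by (simp add: C_def)
  moreover have "\<exists>k. reached s k \<and> x k \<in> points M \<and> f (x k) \<le> f x0 \<and>
      tnorm M (x k) (rgrad M f (x k)) \<le> \<epsilon> \<and>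
      ((\<forall>j. reached s j \<longrightarrow> second_order_progress M R f \<theta> (x j) (\<sigma> j) (s j)) \<and>
        second_order_retraction M R \<longrightarrow> lambda_min (rhess M f (x k)) \<ge> - sqrt \<epsilon>) \<and>
      real k \<le> C * \<epsilon> powr (-1.5) * (1 + \<bar>ln \<epsilon>\<bar>) powr 0"
    if \<epsilon>: "0 < \<epsilon> \<and> \<epsilon> \<le> \<epsilon>0" for \<epsilon>
  proof -
    define \<delta> where "\<delta> = c * sqrt \<epsilon>"
    \<comment> \<open>The threshold must be exceeded strictly, hence floor plus one; it is
      nonnegative, so \<open>nat\<close> does not truncate, and \<open>K\<close> is at most the
      threshold plus 1.\<close>
    define K where "K = nat \<lfloor>A + B * (2 * ((f x0 - flow) / (\<eta>1 * \<sigma>min / 3 * \<delta> ^ 3)) + 1)\<rfloor> + 1"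
    have \<delta>: "\<delta> > 0"
      using c \<epsilon> by (simp add: \<delta>_def)
    have "sqrt \<epsilon> \<le> min r1 r2 / c"
      using \<epsilon> r1 r2 c by (intro real_le_lsqrt) (auto simp: \<epsilon>0_def)
    then have \<delta>_r: "\<delta> \<le> r1" "\<delta> \<le> r2"
      using c by (auto simp: \<delta>_def pos_le_divide_eq mult.commute)
    have pow: "\<epsilon> powr (-1.5) = 1 / sqrt \<epsilon> ^ 3"
    proof -
      have "sqrt \<epsilon> ^ 3 = \<epsilon> powr 1.5"
        using \<epsilon> by (simp add: powr_half_sqrt[symmetric] powr_power)
      then show ?thesis
        by (simp add: powr_minus_divide)
    qed
    have "1 / sqrt \<epsilon> ^ 3 \<ge> 1"
      using \<epsilon> by (simp add: \<epsilon>0_def power_le_one)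
    define X where "X = A + B * (E * \<epsilon> powr (-1.5) + 1)"
    have X: "A + B * (2 * ((f x0 - flow) / (\<eta>1 * \<sigma>min / 3 * \<delta> ^ 3)) + 1) = X"
      unfolding X_def E_def pow \<delta>_def power_mult_distrib by simp
    have "X \<ge> 0"
      using \<open>A \<ge> 0\<close> \<open>B \<ge> 0\<close> \<open>E \<ge> 0\<close> by (simp add: X_def)
    then have "real K \<le> X + 1" and large: "real K > X"
      unfolding K_def X by (simp_all add: of_nat_nat) linarith+
    moreover have "X + 1 \<le> C * \<epsilon> powr (-1.5)"
    proof -
      have "(A + B + 1) * 1 \<le> (A + B + 1) * \<epsilon> powr (-1.5)"
        using \<open>1 / sqrt \<epsilon> ^ 3 \<ge> 1\<close> \<open>A \<ge> 0\<close> \<open>B \<ge> 0\<close> unfolding pow by (intro mult_left_mono) auto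
      then show ?thesis
        by (simp add: X_def C_def algebra_simps)
    qed
    ultimately have K: "real k \<le> C * \<epsilon> powr (-1.5) * (1 + \<bar>ln \<epsilon>\<bar>) powr 0" if "k \<le> K" for k
      using that by simp
    show ?thesis
    proof (cases "reached s K")
      case True
      have "(\<theta> + 2 * \<sigma>max) * \<delta> \<le> (\<theta> + 2 * \<sigma>max) * (1 / (\<theta> + 2 * \<sigma>max) * sqrt \<epsilon>)"
        unfolding \<delta>_def c_def using \<sigma>max parameters \<epsilon> by (intro mult_left_mono mult_right_mono) auto
      then have hess: "(\<theta> + 2 * \<sigma>max) * \<delta> \<le> sqrt \<epsilon>"
        using \<sigma>max parameters by simp
      have "c\<^sup>2 \<le> (sqrt (b / (2 * C1)))\<^sup>2"
        using c by (intro power_mono) (auto simp: c_def)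
      then have "c\<^sup>2 \<le> b / (2 * C1)"
        using C1 \<open>b > 0\<close> by simp
      then have "C1 * c\<^sup>2 \<le> b / 2"
        using C1 by (simp add: field_simps)
      then have "C1 * c\<^sup>2 * \<epsilon> \<le> b / 2 * \<epsilon>"
        using \<epsilon> by (intro mult_right_mono) auto
      then have grad: "(\<bar>L'\<bar> + \<theta> + \<sigma>max) * \<delta>\<^sup>2 \<le> b / 2 * \<epsilon>"
        using \<epsilon> by (simp add: C1_def \<delta>_def power_mult_distrib mult.assoc)
      have "\<exists>j\<le>K. reached s j \<and> tnorm M (x j) (rgrad M f (x j)) \<le> \<epsilon> \<and>
          (second_order_progress M R f \<theta> (x j) (\<sigma> j) (s j) \<and> second_order_retraction M R \<longrightarrow>
            lambda_min (rhess M f (x j)) \<ge> - sqrt \<epsilon>)"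
      proof (rule approximate_minimizer[OF True lower_bound \<delta> _ \<open>b > 0\<close> _ hess grad _ _ gradient_bound])
        show "\<epsilon> > 0" using \<epsilon> by simp
        show "real K > ln (\<sigma>max / \<sigma>min) / ln \<gamma>2 + (1 + ln (1 / \<gamma>1) / ln \<gamma>2) *
            (2 * ((f x0 - flow) / (\<eta>1 * \<sigma>min / 3 * \<delta> ^ 3)) + 1)"
          using large X by (simp add: A_def B_def)
        show "q t \<le> b / 2" if "0 \<le> t" "t < \<delta>" for t
          using r1(2) that \<delta>_r by simp
        show "b \<le> sigma_min M (x k) (R (x k) (s k)) (D_retr M R (x k) (s k))"
          if "successful M R f \<eta>1 x s \<sigma> k" "tnorm M (x k) (s k) < \<delta>" for k
        proof (rule retraction_bound[OF that(1)])
          have "ereal (tnorm M (x k) (s k)) \<le> ereal r2"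
            using that(2) \<delta>_r by simp
          then show "ereal (tnorm M (x k) (s k)) \<le> a"
            using r2(2) by (rule order_trans)
        qed
      qed auto
      then obtain j where j: "j \<le> K" "reached s j" "tnorm M (x j) (rgrad M f (x j)) \<le> \<epsilon>"
        "second_order_progress M R f \<theta> (x j) (\<sigma> j) (s j) \<and> second_order_retraction M R \<longrightarrow>
          lambda_min (rhess M f (x j)) \<ge> - sqrt \<epsilon>" by blast
      then show ?thesis
        using K[OF j(1)] x_in_points[OF j(2)] monotone[OF j(2)] by (intro exI[of _ j]) blast
    next
      case False
      then obtain l where l: "l < K" "s l = 0"
        by (auto simp: reached_def)
      \<comment> \<open>The run stops before iteration \<open>K\<close>. Taking the first zero step
        ensures that iteration \<open>k\<close> is reached, and its iterate is exactly
        critical.\<close>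
      define k where "k = (LEAST k. s k = 0)"
      have sk: "s k = 0" and "k \<le> l"
        unfolding k_def using l(2) by (rule LeastI, rule Least_le)
      have k: "reached s k"
        unfolding reached_def k_def using not_less_Least by blast
      have "tnorm M (x k) (rgrad M f (x k)) = 0"
        using terminated(1)[OF k sk] tnorm_eq_0_iff[OF x_in_points[OF k]] by simp
      moreover have "lambda_min (rhess M f (x k)) \<ge> - sqrt \<epsilon>"
        if "\<forall>j. reached s j \<longrightarrow> second_order_progress M R f \<theta> (x j) (\<sigma> j) (s j)"
          "second_order_retraction M R"
      proof -
        have "- sqrt \<epsilon> \<le> 0"
          using \<epsilon> by simp
        also have "0 \<le> lambda_min (rhess M f (x k))"
          using that k by (intro terminated(2)[OF k sk]) auto
        finally show ?thesis .
      qed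
      ultimately show ?thesis
        using K[of k] k l(1) \<open>k \<le> l\<close> x_in_points[OF k] monotone[OF k] \<epsilon>
        by (intro exI[of _ k]) simp
    qed
  qed
  ultimately show ?thesis
    by (intro exI[of _ \<epsilon>0] exI[of _ C] exI[of _ 0]) auto
qed

end
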